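(* Let $W$ be the $2|1$-dimensional complex $\mathbb Z_2$-graded vector space with basis $w_1$ (odd), $w_2,w_3$ (even), and let $d_*=\psi^{1,1,0}_3$. Then the cohomology of $d_*$ has the following bases (the listed elements are cocycles whose classes form a basis): $$H^1=\langle \psi^{1,0,0}_2,\ \psi^{1,0,0}_3,\ \varphi^{0,1,0}_3,\ \varphi^{0,0,1}_3+\varphi^{1,0,0}_1,\ \varphi^{0,1,0}_2+\varphi^{0,0,1}_3\rangle,$$ $$H^n=\langle \psi^{1,0,n-1}_2,\ \psi^{1,0,n-1}_3,\ \varphi^{0,n,0}_2+\varphi^{0,n-1,1}_3,\ \varphi^{0,0,n}_3+n\,\varphi^{1,0,n-1}_1\rangle,\qquad n>1.$$ In particular $H^1$ has (even$|$odd) dimension $3|2$ and $H^n$ has dimension $2|2$ for $n>1$.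
   Context: All spaces are $\mathbb Z_2$-graded over $\mathbb C$. $S(W)=\bigoplus_{n\ge1}S^n(W)$ is the symmetric coalgebra of $W$ (so $w_1^2=0$). $L_n=\mathrm{Hom}(S^n(W),W)$ for $n\ge1$, $L_0=0$, and $L=\prod_{n\ge1}L_n$ is identified with the coderivations of $S(W)$; it is a $\mathbb Z_2$-graded Lie algebra under the graded commutator $[\cdot,\cdot]$. For a multi-index $I=(i_1,i_2,i_3)$ with $i_1\in\{0,1\}$, $i_2,i_3\ge0$, put $w_I=w_1^{i_1}w_2^{i_2}w_3^{i_3}$, $I!=i_1!i_2!i_3!$, and let $\varphi^I_j\in\mathrm{Hom}(S^{|I|}(W),W)$ be given by $\varphi^I_j(w_J)=I!\,\delta^I_J\,w_j$; when this element is odd it is written $\psi^I_j$. For a codifferential $d\in L_2$ (odd, $[d,d]=0$) let $D(\varphi)=[\varphi,d]$, which maps $L_n$ to $L_{n+1}$ and satisfies $D^2=0$; $H^n=\ker(D:L_n\to L_{n+1})/D(L_{n-1})$ for $n\ge1$. *)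

theory Defs
  imports
    "HOL-Library.Poly_Mapping"
    "HOL-Library.Product_Plus"
    "HOL-Library.Function_Algebras"
    "HOL-Algebra.AbelCoset"
    "Jordan_Normal_Form.VS_Connect"
begin

subsection \<open>The symmetric coalgebra of the 2|1-dimensional space W\<close>

text \<open>
  Exponents \<open>(i1, i2, i3)\<close> of the monomials in \<open>w1\<close> (odd), \<open>w2\<close>, \<open>w3\<close> (even). The coalgebra
  \<open>S(W)\<close> starts in degree 1, so the index 0 is excluded, and \<open>w1^2 = 0\<close> forces \<open>i1 \<le> 1\<close>.
\<close>

fun msize :: "nat \<times> nat \<times> nat \<Rightarrow> nat" where
  "msize (i1, i2, i3) = i1 + i2 + i3"

fun mfact :: "nat \<times> nat \<times> nat \<Rightarrow> nat" where
  "mfact (i1, i2, i3) = fact i1 * fact i2 * fact i3"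

fun mbinom :: "nat \<times> nat \<times> nat \<Rightarrow> nat \<times> nat \<times> nat \<Rightarrow> nat" where
  "mbinom (k1, k2, k3) (j1, j2, j3) = (k1 choose j1) * (k2 choose j2) * (k3 choose j3)"

fun mbelow :: "nat \<times> nat \<times> nat \<Rightarrow> (nat \<times> nat \<times> nat) set" where
  "mbelow (k1, k2, k3) = {..k1} \<times> {..k2} \<times> {..k3}"

definition valid_index :: "nat \<times> nat \<times> nat \<Rightarrow> bool" where
  "valid_index I \<longleftrightarrow> fst I \<le> 1 \<and> 1 \<le> msize I"

typedef mindex = "{I. valid_index I}"
  by (rule exI[of _ "(0, 0, 1)"]) (simp add: valid_index_def)

type_synonym sym = "mindex \<Rightarrow>\<^sub>0 complex"

definition scale :: "complex \<Rightarrow> sym \<Rightarrow> sym" (infixr \<open>\<bullet>s\<close> 75) where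
  "c \<bullet>s x = Poly_Mapping.map ((*) c) x"

definition mon :: "nat \<times> nat \<times> nat \<Rightarrow> sym" where
  "mon I = (if valid_index I then Poly_Mapping.single (Abs_mindex I) 1 else 0)"

definition coeff_at :: "sym \<Rightarrow> nat \<times> nat \<times> nat \<Rightarrow> complex" where
  "coeff_at x I = (if valid_index I then Poly_Mapping.lookup x (Abs_mindex I) else 0)"

definition gen_index :: "nat \<Rightarrow> nat \<times> nat \<times> nat" where
  "gen_index j = (of_bool (j = 1), of_bool (j = 2), of_bool (j = 3))"

definition restr :: "(nat \<times> nat \<times> nat \<Rightarrow> bool) \<Rightarrow> sym \<Rightarrow> sym" where
  "restr P x = (\<Sum>I\<in>{I \<in> Poly_Mapping.keys x. P (Rep_mindex I)}.
                  Poly_Mapping.single I (Poly_Mapping.lookup x I))"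

text \<open>\<open>Spow n\<close> is \<open>S\<^sup>n(W)\<close>; the space \<open>W\<close> itself is identified with \<open>Spow 1\<close>.\<close>

definition Spow :: "nat \<Rightarrow> sym set" where
  "Spow n = {x. \<forall>I\<in>Poly_Mapping.keys x. msize (Rep_mindex I) = n}"

definition corestr :: "sym \<Rightarrow> sym" where
  "corestr = restr (\<lambda>I. msize I = 1)"

text \<open>Parities are 0 and 1; a monomial has the parity of its exponent of \<open>w1\<close>.\<close>

definition parity_proj :: "nat \<Rightarrow> sym \<Rightarrow> sym" where
  "parity_proj p = restr (\<lambda>I. fst I mod 2 = p mod 2)"


subsection \<open>Cochains, coderivations and the bracket\<close>

text \<open>
  \<open>Hom(S\<^sup>n(W), W)\<close>, as the linear maps on \<open>S(W)\<close> with values in \<open>W\<close> that vanish on all other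
  symmetric powers. As \<open>S(W)\<close> has no component of degree 0, \<open>cochains 0\<close> is the zero space.
\<close>

definition cochains :: "nat \<Rightarrow> (sym \<Rightarrow> sym) set" where
  "cochains n = {f. Vector_Spaces.linear scale scale f \<and> (\<forall>x. f x \<in> Spow 1) \<and>
                    (\<forall>k x. k \<noteq> n \<longrightarrow> x \<in> Spow k \<longrightarrow> f x = 0)}"

definition cscale :: "complex \<Rightarrow> (sym \<Rightarrow> sym) \<Rightarrow> (sym \<Rightarrow> sym)" where
  "cscale c f = (\<lambda>x. c \<bullet>s f x)"

text \<open>
  The coderivation of \<open>S(W)\<close> with corestriction \<open>f\<close>, i.e. the sum over all unshuffles
  \<open>f(w_J) w_(K-J)\<close> of \<open>w_K\<close>. There are \<open>mbinom K J\<close> unshuffles with first part \<open>w_J\<close>. All Koszul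
  signs are +1, since \<open>w1\<close> is the only odd generator and occurs at most once in \<open>w_K\<close>; for the same
  reason \<open>w_j w_M\<close> is \<open>mon (gen_index j + M)\<close>, which is 0 if \<open>j = 1\<close> and \<open>w1\<close> occurs in \<open>w_M\<close>.
\<close>

definition coext :: "(sym \<Rightarrow> sym) \<Rightarrow> sym \<Rightarrow> sym" where
  "coext f x = (\<Sum>K\<in>Poly_Mapping.keys x. \<Sum>J\<in>mbelow (Rep_mindex K). \<Sum>j\<in>{1, 2, 3}.
     (Poly_Mapping.lookup x K * of_nat (mbinom (Rep_mindex K) J) * coeff_at (f (mon J)) (gen_index j))
       \<bullet>s mon (gen_index j + (Rep_mindex K - J)))"

text \<open>The component of parity \<open>p\<close> of a linear map.\<close>

definition hpart :: "nat \<Rightarrow> (sym \<Rightarrow> sym) \<Rightarrow> (sym \<Rightarrow> sym)" where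
  "hpart p f = (\<lambda>x. \<Sum>q\<in>{0, 1}. parity_proj (p + q) (f (parity_proj q x)))"

text \<open>\<open>ST - (-1)\<^bsup>|S||T|\<^esup> TS\<close> for homogeneous \<open>S\<close> and \<open>T\<close>, extended bilinearly.\<close>

definition gcomm :: "(sym \<Rightarrow> sym) \<Rightarrow> (sym \<Rightarrow> sym) \<Rightarrow> (sym \<Rightarrow> sym)" where
  "gcomm S T = (\<lambda>x. \<Sum>p\<in>{0, 1}. \<Sum>q\<in>{0, 1}.
     hpart p S (hpart q T x) - (-1) ^ (p * q) \<bullet>s hpart q T (hpart p S x))"

definition bracket :: "(sym \<Rightarrow> sym) \<Rightarrow> (sym \<Rightarrow> sym) \<Rightarrow> (sym \<Rightarrow> sym)" where
  "bracket f g = corestr \<circ> gcomm (coext f) (coext g)"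

definition phi :: "nat \<times> nat \<times> nat \<Rightarrow> nat \<Rightarrow> (sym \<Rightarrow> sym)" where
  "phi I j = (\<lambda>x. (of_nat (mfact I) * coeff_at x I) \<bullet>s mon (gen_index j))"

abbreviation (input) psi :: "nat \<times> nat \<times> nat \<Rightarrow> nat \<Rightarrow> (sym \<Rightarrow> sym)" where
  "psi \<equiv> phi"


subsection \<open>Cohomology of a codifferential\<close>

definition codifferential :: "(sym \<Rightarrow> sym) \<Rightarrow> bool" where
  "codifferential d \<longleftrightarrow> d \<in> cochains 2 \<and> hpart 1 d = d \<and> bracket d d = 0"

definition coboundary :: "(sym \<Rightarrow> sym) \<Rightarrow> (sym \<Rightarrow> sym) \<Rightarrow> (sym \<Rightarrow> sym)" where
  "coboundary d f = bracket f d"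

definition cocycles :: "(sym \<Rightarrow> sym) \<Rightarrow> nat \<Rightarrow> (sym \<Rightarrow> sym) set" where
  "cocycles d n = {f \<in> cochains n. coboundary d f = 0}"

definition coboundaries :: "(sym \<Rightarrow> sym) \<Rightarrow> nat \<Rightarrow> (sym \<Rightarrow> sym) set" where
  "coboundaries d n = coboundary d ` cochains (n - 1)"

text \<open>The fields \<open>mult\<close> and \<open>one\<close> are inherited from the ring record and play no role in modules.\<close>

definition cocycle_space :: "(sym \<Rightarrow> sym) \<Rightarrow> nat \<Rightarrow> (complex, sym \<Rightarrow> sym) module" where
  "cocycle_space d n =
     \<lparr>carrier = cocycles d n, mult = undefined, one = undefined, zero = 0, add = (+), smult = cscale\<rparr>"

definition quotient_module ::
    "('a, 'b, 'c) module_scheme \<Rightarrow> 'b set \<Rightarrow> ('a, 'b set) module" where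
  "quotient_module M N =
     \<lparr>carrier = a_rcosets\<^bsub>M\<^esub> N, mult = undefined, one = undefined, zero = N, add = set_add M,
      smult = (\<lambda>c X. \<Union>x\<in>X. N +>\<^bsub>M\<^esub> (c \<odot>\<^bsub>M\<^esub> x))\<rparr>"

definition cohomology :: "(sym \<Rightarrow> sym) \<Rightarrow> nat \<Rightarrow> (complex, (sym \<Rightarrow> sym) set) module" where
  "cohomology d n = quotient_module (cocycle_space d n) (coboundaries d n)"

definition cohom_class :: "(sym \<Rightarrow> sym) \<Rightarrow> nat \<Rightarrow> (sym \<Rightarrow> sym) \<Rightarrow> (sym \<Rightarrow> sym) set" where
  "cohom_class d n f = coboundaries d n +>\<^bsub>cocycle_space d n\<^esub> f"

definition classes_form_basis :: "(sym \<Rightarrow> sym) \<Rightarrow> nat \<Rightarrow> (sym \<Rightarrow> sym) list \<Rightarrow> bool" where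
  "classes_form_basis d n fs \<longleftrightarrow>
     set fs \<subseteq> cocycles d n \<and> distinct (map (cohom_class d n) fs) \<and>
     vectorspace.basis class_ring (cohomology d n) (cohom_class d n ` set fs)"

text \<open>The subspace of classes of cocycles of parity \<open>p\<close>.\<close>

definition cohomology_part :: "(sym \<Rightarrow> sym) \<Rightarrow> nat \<Rightarrow> nat \<Rightarrow> (complex, (sym \<Rightarrow> sym) set) module" where
  "cohomology_part d n p =
     (cohomology d n)\<lparr>carrier := cohom_class d n ` {f \<in> cocycles d n. hpart p f = f}\<rparr>"

definition cohomology_sdim :: "(sym \<Rightarrow> sym) \<Rightarrow> nat \<Rightarrow> nat \<times> nat" where
  "cohomology_sdim d n =
     (vectorspace.dim class_ring (cohomology_part d n 0),
      vectorspace.dim class_ring (cohomology_part d n 1))"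

definition d_star :: "sym \<Rightarrow> sym" where
  "d_star = psi (1, 1, 0) 3"

lemma lookup_scale: "Poly_Mapping.lookup (c \<bullet>s x) I = c * Poly_Mapping.lookup x I"
  by (simp add: scale_def Poly_Mapping.map.rep_eq when_def)

lemma vector_space_scale: "vector_space scale"
  by unfold_locales (auto intro!: poly_mapping_eqI simp: lookup_scale lookup_add algebra_simps)

lemma scale_zero_left: "0 \<bullet>s x = 0"
  and scale_zero_right: "c \<bullet>s 0 = 0"
  by (auto intro!: poly_mapping_eqI simp: lookup_scale)

lemma lookup_restr:
  "Poly_Mapping.lookup (restr P x) I = (if P (Rep_mindex I) then Poly_Mapping.lookup x I else 0)"
proof -
  have "Poly_Mapping.lookup (restr P x) I =
        (\<Sum>K\<in>{K \<in> Poly_Mapping.keys x. P (Rep_mindex K)}. if K = I then Poly_Mapping.lookup x I else 0)"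
    unfolding restr_def lookup_sum by (intro sum.cong) (auto simp: lookup_single when_def)
  also have "\<dots> = (if P (Rep_mindex I) then Poly_Mapping.lookup x I else 0)"
    by (auto simp: sum.delta in_keys_iff)
  finally show ?thesis .
qed

lemma lookup_phi:
  "Poly_Mapping.lookup (phi I j x) K =
     of_nat (mfact I) * coeff_at x I * Poly_Mapping.lookup (mon (gen_index j)) K"
  by (simp add: phi_def lookup_scale)

lemma phi_in_cochains:
  assumes "valid_index I" "j \<in> {1, 2, 3}"
  shows "phi I j \<in> cochains (msize I)"
proof -
  have "Vector_Spaces.linear scale scale (phi I j)"
    unfolding Vector_Spaces.linear_iff
    by (auto simp: vector_space_scale coeff_at_def lookup_phi lookup_scale
             lookup_add algebra_simps intro!: poly_mapping_eqI)
  moreover have "phi I j x \<in> Spow 1" for x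
  proof -
    have v: "valid_index (gen_index j)" "msize (gen_index j) = 1"
      using assms(2) by (auto simp: gen_index_def valid_index_def)
    have "msize (Rep_mindex K) = 1" if "Poly_Mapping.lookup (phi I j x) K \<noteq> 0" for K
      using that v by (auto simp: lookup_phi mon_def lookup_single when_def Abs_mindex_inverse
                            split: if_splits)
    then show ?thesis by (auto simp: Spow_def in_keys_iff)
  qed
  moreover have "phi I j x = 0" if "k \<noteq> msize I" "x \<in> Spow k" for k x
  proof -
    have "Abs_mindex I \<notin> Poly_Mapping.keys x"
      using that assms(1) by (auto simp: Spow_def Abs_mindex_inverse)
    then have "coeff_at x I = 0" by (simp add: coeff_at_def in_keys_iff)
    then show ?thesis by (simp add: phi_def scale_zero_left)
  qed
  ultimately show ?thesis by (simp add: cochains_def)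
qed

lemma phi_mon:
  assumes "valid_index I" "valid_index J"
  shows "phi I j (mon J) = (of_nat (mfact I) * of_bool (I = J)) \<bullet>s mon (gen_index j)"
proof -
  have "coeff_at (mon J) I = of_bool (I = J)"
    using assms by (auto simp: coeff_at_def mon_def lookup_single when_def Abs_mindex_inject)
  then show ?thesis by (simp add: phi_def)
qed

text \<open>\<open>d_star\<close> sends monomials containing \<open>w1\<close> to monomials not containing it.\<close>

lemma coext_d_star_support:
  assumes "Poly_Mapping.lookup (coext d_star x) I \<noteq> 0"
  shows "fst (Rep_mindex I) = 0 \<and> (\<exists>K\<in>Poly_Mapping.keys x. fst (Rep_mindex K) = 1)"
proof -
  from assms obtain K J j where K: "K \<in> Poly_Mapping.keys x" and J: "J \<in> mbelow (Rep_mindex K)"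
    and j: "j \<in> {1, 2, 3}"
    and nz: "coeff_at (d_star (mon J)) (gen_index j) \<noteq> 0"
      "Poly_Mapping.lookup (mon (gen_index j + (Rep_mindex K - J))) I \<noteq> 0"
    unfolding coext_def lookup_sum lookup_scale
    by (smt (verit) mult_eq_0_iff sum.not_neutral_contains_not_neutral)
  have J0: "J = (1, 1, 0)"
  proof (rule ccontr)
    assume "J \<noteq> (1, 1, 0)"
    then have "coeff_at (mon J) (1, 1, 0) = 0"
      by (auto simp: coeff_at_def mon_def lookup_single when_def Abs_mindex_inject)
    then have "d_star (mon J) = 0" by (simp add: d_star_def phi_def scale_zero_left)
    then show False using nz(1) by (simp add: coeff_at_def split: if_splits)
  qed
  have j3: "j = 3"
  proof (rule ccontr)
    assume "j \<noteq> 3"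
    then have "gen_index j \<noteq> gen_index 3" using j by (auto simp: gen_index_def)
    then have "coeff_at (mon (gen_index 3)) (gen_index j) = 0"
      by (auto simp: coeff_at_def mon_def lookup_single when_def Abs_mindex_inject)
    then show False using nz(1) by (auto simp: d_star_def phi_def coeff_at_def lookup_scale split: if_splits)
  qed
  obtain k1 k2 k3 where Keq: "Rep_mindex K = (k1, k2, k3)" by (metis prod_cases3)
  have "valid_index (Rep_mindex K)" using Rep_mindex[of K] by simp
  then have k1: "k1 = 1" using J J0 by (simp add: Keq valid_index_def)
  have "Rep_mindex I = gen_index j + (Rep_mindex K - J)"
    using nz(2) by (auto simp: mon_def lookup_single when_def Abs_mindex_inverse split: if_splits)
  then have "fst (Rep_mindex I) = 0" using Keq J0 j3 k1 by (simp add: gen_index_def)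
  then show ?thesis using K Keq k1 by force
qed

lemma fst_Rep_cases: "fst (Rep_mindex I) = 0 \<or> fst (Rep_mindex I) = 1"
  using Rep_mindex[of I] by (auto simp: valid_index_def)

lemma keys_parity_proj:
  "I \<in> Poly_Mapping.keys (parity_proj p x) \<longleftrightarrow>
     I \<in> Poly_Mapping.keys x \<and> fst (Rep_mindex I) mod 2 = p mod 2"
  by (auto simp: parity_proj_def in_keys_iff lookup_restr)

lemma coext_d_star_parity0: "coext d_star (parity_proj 0 x) = 0"
proof (rule poly_mapping_eqI, rule ccontr)
  fix I assume "Poly_Mapping.lookup (coext d_star (parity_proj 0 x)) I \<noteq> Poly_Mapping.lookup 0 I"
  then show False using coext_d_star_support[of "parity_proj 0 x" I] by (auto simp: keys_parity_proj)
qed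

lemma coext_zero: "coext f 0 = 0"
  by (simp add: coext_def)

lemma hpart_coext_d_star:
  "hpart 0 (coext d_star) = (\<lambda>x. 0)"
  "hpart 1 (coext d_star) = (\<lambda>x. coext d_star (parity_proj 1 x))"
proof -
  have z: "parity_proj p 0 = 0" for p by (simp add: parity_proj_def restr_def)
  have 1: "parity_proj 1 (coext d_star y) = 0" for y
    by (rule poly_mapping_eqI) (use coext_d_star_support[of y] in \<open>force simp: parity_proj_def lookup_restr\<close>)
  have 2: "parity_proj 2 (coext d_star y) = coext d_star y" for y
    by (rule poly_mapping_eqI) (use coext_d_star_support[of y] in \<open>force simp: parity_proj_def lookup_restr\<close>)
  show "hpart 0 (coext d_star) = (\<lambda>x. 0)"
    using 1 by (simp add: hpart_def coext_d_star_parity0 z)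
  show "hpart 1 (coext d_star) = (\<lambda>x. coext d_star (parity_proj 1 x))"
    using 2 by (simp add: hpart_def coext_d_star_parity0 z numeral_2_eq_2)
qed

lemma codifferential_d_star: "codifferential d_star"
proof -
  have "d_star \<in> cochains (msize (1, 1, 0))"
    unfolding d_star_def by (rule phi_in_cochains) (simp_all add: valid_index_def)
  moreover have "msize (1, 1, 0) = 2" by simp
  ultimately have 1: "d_star \<in> cochains 2" by metis
  have 2: "hpart 1 d_star = d_star"
  proof (rule ext, rule poly_mapping_eqI)
    fix x I
    show "Poly_Mapping.lookup (hpart 1 d_star x) I = Poly_Mapping.lookup (d_star x) I"
      by (auto simp: hpart_def d_star_def lookup_add parity_proj_def lookup_restr lookup_phi coeff_at_def
           mon_def gen_index_def lookup_single when_def Abs_mindex_inverse valid_index_def)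
  qed
  have sq: "coext d_star (parity_proj 1 (coext d_star y)) = 0" for y
  proof -
    have "parity_proj 1 (coext d_star y) = 0"
      by (rule poly_mapping_eqI) (use coext_d_star_support[of y] in \<open>force simp: parity_proj_def lookup_restr\<close>)
    then show ?thesis by (simp add: coext_zero)
  qed
  have z: "parity_proj p 0 = 0" for p by (simp add: parity_proj_def restr_def)
  have "gcomm (coext d_star) (coext d_star) = (\<lambda>x. 0)"
    unfolding gcomm_def
    by (rule ext) (simp add: hpart_coext_d_star hpart_coext_d_star[unfolded One_nat_def]
        sq sq[unfolded One_nat_def] z coext_zero scale_zero_right)
  then have 3: "bracket d_star d_star = 0"
    by (auto simp: bracket_def corestr_def restr_def)
  show ?thesis using 1 2 3 by (simp add: codifferential_def)
qed

end

theory Submission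
  imports Defs
begin

text \<open>
  Let \<open>p\<^sub>j(b,c)\<close> and \<open>q\<^sub>j(b,c)\<close> be the \<open>w\<^sub>j\<close>-coefficients of the values of a cochain at \<open>w\<^sub>2\<^sup>b w\<^sub>3\<^sup>c\<close>
  and \<open>w\<^sub>1 w\<^sub>2\<^sup>b w\<^sub>3\<^sup>c\<close>. The coboundary has the coefficients
  \<open>p\<^sub>3'(b,c) = b p\<^sub>1(b-1,c)\<close>, \<open>q\<^sub>1'(b,c) = b p\<^sub>1(b-1,c+1)\<close>, \<open>q\<^sub>2'(b,c) = b p\<^sub>2(b-1,c+1)\<close>,
  \<open>q\<^sub>3'(b,c) = b (p\<^sub>3(b-1,c+1) - q\<^sub>1(b-1,c)) - p\<^sub>2(b,c)\<close>, and the others vanish. For \<open>n > 1\<close> a cocycle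
  in \<open>L\<^sub>n\<close> is therefore a coboundary iff \<open>q\<^sub>2(0,n-1)\<close>, \<open>q\<^sub>3(0,n-1) + q\<^sub>2(1,n-2)\<close>, \<open>p\<^sub>2(n,0)\<close> and
  \<open>p\<^sub>3(0,n)\<close> vanish: dividing by \<open>b\<close> solves for a primitive. Up to scaling, these four functionals are
  dual to the claimed basis. For \<open>n = 1\<close> there are no coboundaries, and five coefficients determine
  a cocycle.
\<close>

subsection \<open>Bases of quotients from dual functionals\<close>

lemma vectorspace_sum_functional:
  fixes V :: "('a::field, 'b, 'c) module_scheme" and l :: "'b \<Rightarrow> 'a"
  assumes V: "vectorspace class_ring V"
    and add: "\<And>v w. v \<in> carrier V \<Longrightarrow> w \<in> carrier V \<Longrightarrow> l (v \<oplus>\<^bsub>V\<^esub> w) = l v + l w"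
    and smult: "\<And>c v. v \<in> carrier V \<Longrightarrow> l (c \<odot>\<^bsub>V\<^esub> v) = c * l v"
    and A: "finite A" "A \<subseteq> carrier V"
  shows "l (module.lincomb V a A) = (\<Sum>v\<in>A. a v * l v)"
proof -
  interpret V: vectorspace class_ring V by (rule V)
  have "l \<zero>\<^bsub>V\<^esub> = 0"
    using smult[of "\<zero>\<^bsub>V\<^esub>" 0] V.zero_closed V.smult_r_null by auto
  with A show ?thesis
    unfolding V.lincomb_def
  proof (induction A rule: finite_induct)
    case (insert v A)
    then have "(\<lambda>v. a v \<odot>\<^bsub>V\<^esub> v) \<in> A \<rightarrow> carrier V" "a v \<odot>\<^bsub>V\<^esub> v \<in> carrier V"
      by (auto intro!: V.smult_closed)
    with insert show ?case
      by (simp add: V.finsum_insert add smult V.finsum_closed)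
  qed simp
qed

text \<open>Applying \<open>l b\<close> to a linear combination returns the coefficient of
  \<open>b\<close>, so \<open>B\<close> is independent. The difference between \<open>v\<close> and
  the combination with coefficients \<open>l b v\<close> is killed by every functional, so
  \<open>separate\<close> makes it zero and \<open>B\<close> spans.\<close>

lemma basisI_dual_functionals:
  fixes V :: "('a::field, 'b, 'c) module_scheme" and l :: "'b \<Rightarrow> 'b \<Rightarrow> 'a"
  assumes V: "vectorspace class_ring V"
    and B: "finite B" "B \<subseteq> carrier V"
    and add: "\<And>b v w. b \<in> B \<Longrightarrow> v \<in> carrier V \<Longrightarrow> w \<in> carrier V \<Longrightarrow> l b (v \<oplus>\<^bsub>V\<^esub> w) = l b v + l b w"
    and smult: "\<And>b c v. b \<in> B \<Longrightarrow> v \<in> carrier V \<Longrightarrow> l b (c \<odot>\<^bsub>V\<^esub> v) = c * l b v"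
    and dual: "\<And>b b'. b \<in> B \<Longrightarrow> b' \<in> B \<Longrightarrow> l b b' = of_bool (b = b')"
    and separate: "\<And>v. v \<in> carrier V \<Longrightarrow> (\<And>b. b \<in> B \<Longrightarrow> l b v = 0) \<Longrightarrow> v = \<zero>\<^bsub>V\<^esub>"
  shows "vectorspace.basis class_ring V B"
proof -
  interpret V: vectorspace class_ring V by (rule V)
  have lin: "l b (V.lincomb a B) = a b" if "b \<in> B" for a b
  proof -
    have "l b (V.lincomb a B) = (\<Sum>v\<in>B. a v * l b v)"
      by (rule vectorspace_sum_functional[OF V]) (use add smult that B in auto)
    also have "\<dots> = (\<Sum>v\<in>B. if v = b then a b else 0)"
      by (rule sum.cong) (use that dual in auto)
    finally show ?thesis using that B by simp
  qed
  have "V.lin_indpt B"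
  proof (rule V.finite_lin_indpt2[OF B])
    fix a assume "V.lincomb a B = \<zero>\<^bsub>V\<^esub>"
    moreover have "l b \<zero>\<^bsub>V\<^esub> = 0" if "b \<in> B" for b
      using smult[OF that, of "\<zero>\<^bsub>V\<^esub>" 0] V.zero_closed V.smult_r_null by auto
    ultimately show "\<forall>b\<in>B. a b = \<zero>\<^bsub>class_ring\<^esub>"
      using lin by (metis ring_record_simps(11))
  qed
  moreover have "v \<in> V.span B" if v: "v \<in> carrier V" for v
  proof -
    let ?s = "V.lincomb (\<lambda>b. l b v) B"
    have s: "?s \<in> carrier V" using B by (intro V.lincomb_closed) auto
    have "v \<oplus>\<^bsub>V\<^esub> (- 1) \<odot>\<^bsub>V\<^esub> ?s = \<zero>\<^bsub>V\<^esub>"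
    proof (rule separate)
      show "v \<oplus>\<^bsub>V\<^esub> (- 1) \<odot>\<^bsub>V\<^esub> ?s \<in> carrier V"
        using v s by (intro V.add.m_closed V.smult_closed) auto
      show "l b (v \<oplus>\<^bsub>V\<^esub> (- 1) \<odot>\<^bsub>V\<^esub> ?s) = 0" if "b \<in> B" for b
        using that v s by (subst add) (auto simp: smult lin intro!: V.smult_closed)
    qed
    moreover have "?s \<oplus>\<^bsub>V\<^esub> (- 1) \<odot>\<^bsub>V\<^esub> ?s = \<zero>\<^bsub>V\<^esub>"
    proof (rule separate)
      show "?s \<oplus>\<^bsub>V\<^esub> (- 1) \<odot>\<^bsub>V\<^esub> ?s \<in> carrier V"
        using s by (intro V.add.m_closed V.smult_closed) auto
      show "l b (?s \<oplus>\<^bsub>V\<^esub> (- 1) \<odot>\<^bsub>V\<^esub> ?s) = 0" if "b \<in> B" for b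
        using that s by (subst add) (auto simp: smult lin intro!: V.smult_closed)
    qed
    moreover have "(- 1) \<odot>\<^bsub>V\<^esub> ?s \<in> carrier V"
      using s by (intro V.smult_closed) auto
    ultimately have "v = ?s"
      using v s by (metis V.add.right_cancel)
    then show ?thesis
      using B by (auto simp: V.finite_span)
  qed
  ultimately show ?thesis
    using B V.span_is_subset2 by (auto simp: V.basis_def)
qed

text \<open>All that the quotient construction takes from \<open>d\<close> is that the coboundaries
  form a subspace. For \<open>d_star\<close> this is supplied later, once linearity of the
  coboundary has been read off in coordinates.\<close>

locale coboundary_subspace =
  fixes d :: "sym \<Rightarrow> sym" and n :: nat
  assumes zero_coboundary: "0 \<in> coboundaries d n"
    and add_coboundary: "f \<in> coboundaries d n \<Longrightarrow> g \<in> coboundaries d n \<Longrightarrow> f + g \<in> coboundaries d n"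
    and cscale_coboundary: "f \<in> coboundaries d n \<Longrightarrow> cscale c f \<in> coboundaries d n"
begin

abbreviation cls where "cls \<equiv> cohom_class d n"

lemma cscale_minus: "cscale (- 1) f = - f"
  by (auto simp: cscale_def fun_eq_iff lookup_scale intro!: poly_mapping_eqI)

lemma diff_coboundary: "f \<in> coboundaries d n \<Longrightarrow> g \<in> coboundaries d n \<Longrightarrow> f - g \<in> coboundaries d n"
  using add_coboundary[of f "cscale (-1) g"] cscale_coboundary[of g "-1"] by (simp add: cscale_minus)

lemma mem_cls: "h \<in> cls f \<longleftrightarrow> h - f \<in> coboundaries d n"
  by (auto simp: cohom_class_def a_r_coset_def' cocycle_space_def intro!: bexI[of _ "h - f"])

lemma self_mem_cls: "f \<in> cls f"
  by (simp add: mem_cls zero_coboundary)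

lemma cls_eqI:
  assumes "f - g \<in> coboundaries d n"
  shows "cls f = cls g"
proof (intro Set.set_eqI)
  fix h
  have "h - g = (h - f) + (f - g)" "h - f = (h - g) - (f - g)" by (simp_all add: algebra_simps)
  then show "h \<in> cls f \<longleftrightarrow> h \<in> cls g"
    unfolding mem_cls using assms add_coboundary diff_coboundary by metis
qed

lemma cls_zero: "cls 0 = coboundaries d n"
  by (auto simp: mem_cls)

lemma cscale_diff: "cscale c f - cscale c g = cscale c (f - g)"
  by (auto simp: cscale_def fun_eq_iff lookup_scale lookup_minus right_diff_distrib intro!: poly_mapping_eqI)

lemma add_cls: "cls f \<oplus>\<^bsub>cohomology d n\<^esub> cls g = cls (f + g)"
proof -
  have "cls f \<oplus>\<^bsub>cohomology d n\<^esub> cls g = {x + y | x y. x \<in> cls f \<and> y \<in> cls g}"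
    by (auto simp: cohomology_def quotient_module_def set_add_def' cocycle_space_def)
  also have "\<dots> = cls (f + g)"
  proof (intro Set.set_eqI iffI)
    fix h assume "h \<in> {x + y | x y. x \<in> cls f \<and> y \<in> cls g}"
    then obtain x y where "h = x + y" "x - f \<in> coboundaries d n" "y - g \<in> coboundaries d n"
      by (auto simp: mem_cls)
    moreover have "(x + y) - (f + g) = (x - f) + (y - g)" by (simp add: algebra_simps)
    ultimately show "h \<in> cls (f + g)" by (simp only: mem_cls add_coboundary)
  next
    fix h assume "h \<in> cls (f + g)"
    then have "h - g \<in> cls f" by (simp add: mem_cls algebra_simps)
    moreover have "h = (h - g) + g" by simp
    ultimately show "h \<in> {x + y | x y. x \<in> cls f \<and> y \<in> cls g}"
      using self_mem_cls by blast
  qed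
  finally show ?thesis .
qed

text \<open>Scalar multiplication in the quotient is a union over all representatives. Each of them
  contributes the same class, and the union is over a nonempty set, so it collapses to that
  class.\<close>

lemma smult_cls: "c \<odot>\<^bsub>cohomology d n\<^esub> cls f = cls (cscale c f)"
proof -
  have "cls (cscale c x) = cls (cscale c f)" if "x \<in> cls f" for x
    using that by (intro cls_eqI) (auto simp: cscale_diff mem_cls cscale_coboundary)
  then have "(\<Union>x\<in>cls f. cls (cscale c x)) = (\<Union>x\<in>cls f. cls (cscale c f))"
    by (rule SUP_cong[OF refl])
  also have "\<dots> = cls (cscale c f)"
    by (metis UN_constant empty_iff self_mem_cls)
  finally have "(\<Union>x\<in>cls f. cls (cscale c x)) = cls (cscale c f)" .
  then show ?thesis
    by (simp add: cohomology_def quotient_module_def cohom_class_def cocycle_space_def)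
qed

text \<open>With all cocycles for \<open>Z\<close> this is the whole cohomology, with the cocycles
  of one parity it is a homogeneous part. Keeping \<open>Z\<close> variable gives bases and
  superdimensions from one argument.\<close>

abbreviation cohomology_of where
  "cohomology_of Z \<equiv> (cohomology d n)\<lparr>carrier := cls ` Z\<rparr>"

lemma cohomology_eq_cohomology_of: "cohomology d n = cohomology_of (cocycles d n)"
  by (auto simp: cohomology_def quotient_module_def cohom_class_def A_RCOSETS_def' cocycle_space_def)

lemma vectorspace_cohomology_of:
  assumes zero: "0 \<in> Z" and add: "\<And>f g. f \<in> Z \<Longrightarrow> g \<in> Z \<Longrightarrow> f + g \<in> Z"
    and scale: "\<And>c f. f \<in> Z \<Longrightarrow> cscale c f \<in> Z"
  shows "vectorspace class_ring (cohomology_of Z)"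
proof -
  have z: "\<zero>\<^bsub>cohomology d n\<^esub> = cls 0"
    by (simp add: cls_zero) (simp add: cohomology_def quotient_module_def)
  have cs: "cscale a (f + g) = cscale a f + cscale a g" "cscale (a + b) f = cscale a f + cscale b f"
    "cscale (a * b) f = cscale a (cscale b f)" "cscale 1 f = f" for a b f g
    by (auto simp: cscale_def fun_eq_iff lookup_scale lookup_add algebra_simps intro!: poly_mapping_eqI)
  have "Module.module class_ring (cohomology_of Z)"
  proof (rule module_criteria)
    show "cring (class_ring :: complex ring)" by (rule class_cring.cring_axioms)
    show "\<forall>v\<in>carrier (cohomology_of Z). \<exists>w\<in>carrier (cohomology_of Z).
        v \<oplus>\<^bsub>cohomology_of Z\<^esub> w = \<zero>\<^bsub>cohomology_of Z\<^esub>"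
    proof
      fix v assume "v \<in> carrier (cohomology_of Z)"
      then obtain f where "f \<in> Z" "v = cls f" by auto
      then show "\<exists>w\<in>carrier (cohomology_of Z). v \<oplus>\<^bsub>cohomology_of Z\<^esub> w = \<zero>\<^bsub>cohomology_of Z\<^esub>"
        using scale[of f "-1"] by (auto simp: add_cls z cscale_minus intro!: bexI[of _ "- f"])
    qed
  qed (use zero add scale in \<open>auto simp: add_cls smult_cls z cs add_ac\<close>)
  then show ?thesis
    by (simp add: vectorspace_def class_field)
qed

text \<open>Functionals that vanish on coboundaries are constant on classes and so descend to the
  quotient, where the criterion for dual functionals applies. Lists pair each functional with its
  cocycle by position, and duality also shows that the listed classes are distinct, which makes the
  dimension equal to the length.\<close>

lemma cohomology_of_dual_functionals:
  fixes ls :: "((sym \<Rightarrow> sym) \<Rightarrow> complex) list"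
  assumes Z: "0 \<in> Z" "\<And>f g. f \<in> Z \<Longrightarrow> g \<in> Z \<Longrightarrow> f + g \<in> Z" "\<And>c f. f \<in> Z \<Longrightarrow> cscale c f \<in> Z"
    and fs: "set fs \<subseteq> Z" and len: "length ls = length fs"
    and add: "\<forall>l\<in>set ls. \<forall>f g. l (f + g) = l f + l g"
    and scale: "\<forall>l\<in>set ls. \<forall>c f. l (cscale c f) = c * l f"
    and vanish: "\<forall>l\<in>set ls. \<forall>f\<in>coboundaries d n. l f = 0"
    and dual: "\<forall>i<length fs. \<forall>j<length fs. (ls ! i) (fs ! j) = of_bool (i = j)"
    and separate: "\<And>f. f \<in> Z \<Longrightarrow> \<forall>l\<in>set ls. l f = 0 \<Longrightarrow> f \<in> coboundaries d n"
  shows "distinct (map cls fs) \<and>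
    vectorspace.basis class_ring (cohomology_of Z) (cls ` set fs) \<and>
    vectorspace.dim class_ring (cohomology_of Z) = length fs"
proof -
  have ls: "ls ! i \<in> set ls" if "i < length fs" for i
    using that len by simp
  note l_add = add[rule_format] and l_scale = scale[rule_format]
  have l_mem: "l g = l f" if "l \<in> set ls" "g \<in> cls f" for l f g
    using l_add[OF that(1), of "g - f" f] vanish that
    by (simp add: mem_cls)
  have l_some: "l (SOME g. g \<in> cls f) = l f" if "l \<in> set ls" for l f
    using that by (rule l_mem) (rule someI[of "\<lambda>g. g \<in> cls f", OF self_mem_cls])
  have inj: "i = j" if "i < length fs" "j < length fs" "cls (fs ! i) = cls (fs ! j)" for i j
    using l_mem[OF ls, of i "fs ! i" "fs ! j"] self_mem_cls[of "fs ! i"] dual that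
    by (auto split: if_splits)
  then have dist: "distinct (map cls fs)"
    by (auto simp: distinct_conv_nth)
  have V: "vectorspace class_ring (cohomology_of Z)"
    by (rule vectorspace_cohomology_of) (use Z in auto)
  \<comment> \<open>The criterion indexes functionals by basis vectors, here classes. By
    \<open>inj\<close> a class determines its position in the list; the descended functional is
    evaluated at an arbitrary representative chosen by \<open>SOME\<close>.\<close>
  define ix where "ix b = (SOME i. i < length fs \<and> b = cls (fs ! i))" for b
  have ix: "ix (cls (fs ! i)) = i" if "i < length fs" for i
    unfolding ix_def by (rule some_equality) (use that inj in auto)
  have B: "b \<in> cls ` set fs \<longleftrightarrow> (\<exists>i<length fs. b = cls (fs ! i))" for b
    by (auto simp: in_set_conv_nth image_iff Bex_def)
  have basis: "vectorspace.basis class_ring (cohomology_of Z) (cls ` set fs)"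
  proof (rule basisI_dual_functionals[OF V, where l = "\<lambda>b X. (ls ! ix b) (SOME g. g \<in> X)"])
    fix v assume "v \<in> carrier (cohomology_of Z)"
      and 0: "\<And>b. b \<in> cls ` set fs \<Longrightarrow> (ls ! ix b) (SOME g. g \<in> v) = 0"
    then obtain f where f: "f \<in> Z" "v = cls f" by auto
    have "(ls ! i) f = 0" if "i < length fs" for i
      using 0[of "cls (fs ! i)"] that ix l_some[OF ls] f by auto
    then have "\<forall>l\<in>set ls. l f = 0" using len by (auto simp: in_set_conv_nth)
    then have "f \<in> coboundaries d n" using separate f by blast
    then have "v = cls 0" using f cls_eqI[of f 0] by simp
    then show "v = \<zero>\<^bsub>cohomology_of Z\<^esub>"
      by (simp add: cls_zero) (simp add: cohomology_def quotient_module_def)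
  next
    fix b b' assume "b \<in> cls ` set fs" "b' \<in> cls ` set fs"
    then obtain i j where "i < length fs" "b = cls (fs ! i)" "j < length fs" "b' = cls (fs ! j)"
      unfolding B by blast
    then show "(ls ! ix b) (SOME g. g \<in> b') = of_bool (b = b')"
      using inj dual by (auto simp: ix l_some[OF ls])
  next
    fix b v w assume "b \<in> cls ` set fs" "v \<in> carrier (cohomology_of Z)" "w \<in> carrier (cohomology_of Z)"
    then obtain i f g where "i < length fs" "b = cls (fs ! i)" "v = cls f" "w = cls g"
      unfolding B by auto
    then show "(ls ! ix b) (SOME g. g \<in> v \<oplus>\<^bsub>cohomology_of Z\<^esub> w) =
        (ls ! ix b) (SOME g. g \<in> v) + (ls ! ix b) (SOME g. g \<in> w)"
      by (simp add: ix l_some[OF ls] add_cls l_add[OF ls])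
  next
    fix b c v assume "b \<in> cls ` set fs" "v \<in> carrier (cohomology_of Z)"
    then obtain i f where "i < length fs" "b = cls (fs ! i)" "v = cls f"
      unfolding B by auto
    then show "(ls ! ix b) (SOME g. g \<in> c \<odot>\<^bsub>cohomology_of Z\<^esub> v) = c * (ls ! ix b) (SOME g. g \<in> v)"
      by (simp add: ix l_some[OF ls] smult_cls l_scale[OF ls])
  next
    show "finite (cls ` set fs)" by simp
    show "cls ` set fs \<subseteq> carrier (cohomology_of Z)" using fs by auto
  qed
  have "vectorspace.dim class_ring (cohomology_of Z) = length fs"
    using vectorspace.dim_basis[OF V _ basis] distinct_card[OF dist] by simp
  with dist basis show ?thesis by simp
qed

end

subsection \<open>Coordinates\<close>

lemma coeff_at_add: "coeff_at (x + y) I = coeff_at x I + coeff_at y I"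
  and coeff_at_diff: "coeff_at (x - y) I = coeff_at x I - coeff_at y I"
  and coeff_at_scale: "coeff_at (c \<bullet>s x) I = c * coeff_at x I"
  and coeff_at_zero: "coeff_at 0 I = 0"
  by (simp_all add: coeff_at_def lookup_add lookup_minus lookup_scale)

lemma coeff_at_sum: "coeff_at (\<Sum>a\<in>A. f a) I = (\<Sum>a\<in>A. coeff_at (f a) I)"
  by (induction A rule: infinite_finite_induct) (simp_all add: coeff_at_add coeff_at_zero)

lemmas coeff_at_linear = coeff_at_add coeff_at_diff coeff_at_scale coeff_at_zero coeff_at_sum

lemma coeff_at_mon: "coeff_at (mon I) J = of_bool (valid_index I \<and> I = J)"
  by (auto simp: coeff_at_def mon_def lookup_single when_def Abs_mindex_inject)

lemma coeff_at_restr: "coeff_at (restr P x) I = (if P I then coeff_at x I else 0)"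
  by (simp add: coeff_at_def lookup_restr Abs_mindex_inverse)

lemma lookup_eq_coeff_at: "Poly_Mapping.lookup x K = coeff_at x (Rep_mindex K)"
  using Rep_mindex[of K] by (simp add: coeff_at_def Rep_mindex_inverse)

lemma sym_eqI: "(\<And>I. valid_index I \<Longrightarrow> coeff_at x I = coeff_at y I) \<Longrightarrow> x = y"
  using Rep_mindex by (intro poly_mapping_eqI) (simp add: lookup_eq_coeff_at)

lemma Spow_iff: "x \<in> Spow n \<longleftrightarrow> (\<forall>I. msize I \<noteq> n \<longrightarrow> coeff_at x I = 0)"
proof
  assume x: "x \<in> Spow n"
  show "\<forall>I. msize I \<noteq> n \<longrightarrow> coeff_at x I = 0"
  proof (intro allI impI)
    fix I assume I: "msize I \<noteq> n"
    have "Abs_mindex I \<notin> Poly_Mapping.keys x" if "valid_index I"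
    proof
      assume "Abs_mindex I \<in> Poly_Mapping.keys x"
      with x have "msize (Rep_mindex (Abs_mindex I)) = n" by (simp add: Spow_def)
      with I that show False by (simp add: Abs_mindex_inverse)
    qed
    then show "coeff_at x I = 0" by (simp add: coeff_at_def in_keys_iff)
  qed
next
  assume x: "\<forall>I. msize I \<noteq> n \<longrightarrow> coeff_at x I = 0"
  have "msize (Rep_mindex K) = n" if "K \<in> Poly_Mapping.keys x" for K
  proof (rule ccontr)
    assume "msize (Rep_mindex K) \<noteq> n"
    with x[rule_format] that show False by (simp add: in_keys_iff lookup_eq_coeff_at)
  qed
  then show "x \<in> Spow n" by (simp add: Spow_def)
qed

lemma msize_1_cases:
  assumes "msize I = 1"
  obtains j where "j \<in> {1, 2, 3}" "I = gen_index j"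
proof -
  obtain a b c where I: "I = (a, b, c)" by (metis prod_cases3)
  have "a + b + c = 1" using assms I by simp
  then consider "a = 1" "b = 0" "c = 0" | "a = 0" "b = 1" "c = 0" | "a = 0" "b = 0" "c = 1"
    by linarith
  then show ?thesis
    by cases (use that[of 1] that[of 2] that[of 3] in \<open>auto simp: I gen_index_def\<close>)
qed

lemma valid_gen_index: "j \<in> {1, 2, 3} \<Longrightarrow> valid_index (gen_index j)"
  by (auto simp: gen_index_def valid_index_def)

lemma inj_gen_index: "inj_on gen_index {1, 2, 3}"
  by (auto simp: inj_on_def gen_index_def)

lemma linear_scale_iff:
  "Vector_Spaces.linear scale scale f \<longleftrightarrow> (\<forall>x y. f (x + y) = f x + f y) \<and> (\<forall>c x. f (c \<bullet>s x) = c \<bullet>s f x)"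
  by (simp add: Vector_Spaces.linear_iff vector_space_scale)

lemma sym_expansion: "x = (\<Sum>K\<in>Poly_Mapping.keys x. Poly_Mapping.lookup x K \<bullet>s mon (Rep_mindex K))"
proof (rule poly_mapping_eqI)
  fix I
  have "Poly_Mapping.lookup (mon (Rep_mindex K)) I = of_bool (K = I)" for K
    using Rep_mindex[of K] by (auto simp: mon_def Rep_mindex_inverse lookup_single when_def)
  then have "(\<Sum>K\<in>Poly_Mapping.keys x. Poly_Mapping.lookup (Poly_Mapping.lookup x K \<bullet>s mon (Rep_mindex K)) I)
      = (\<Sum>K\<in>Poly_Mapping.keys x. if K = I then Poly_Mapping.lookup x I else 0)"
    by (intro sum.cong) (auto simp: lookup_scale)
  then show "Poly_Mapping.lookup x I =
      Poly_Mapping.lookup (\<Sum>K\<in>Poly_Mapping.keys x. Poly_Mapping.lookup x K \<bullet>s mon (Rep_mindex K)) I"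
    by (simp add: lookup_sum in_keys_iff)
qed

lemma linear_eq_on_mon:
  assumes f: "Vector_Spaces.linear scale scale f" and g: "Vector_Spaces.linear scale scale g"
    and mon: "\<And>K. valid_index K \<Longrightarrow> f (mon K) = g (mon K)"
  shows "f = g"
proof
  fix x
  have "h x = (\<Sum>K\<in>Poly_Mapping.keys x. Poly_Mapping.lookup x K \<bullet>s h (mon (Rep_mindex K)))"
    if h: "Vector_Spaces.linear scale scale h" for h
  proof -
    interpret h: Vector_Spaces.linear scale scale h by (rule h)
    show ?thesis by (subst (1) sym_expansion) (simp only: h.sum h.scale)
  qed
  then show "f x = g x"
    using f g mon Rep_mindex by (metis (no_types, lifting) mem_Collect_eq sum.cong)
qed

text \<open>
  The coordinate formulas for the bracket need no bound on the degree, so they are stated for all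
  linear maps with values in \<open>W\<close> instead of for the \<open>cochains n\<close>.
\<close>

definition Wmaps :: "(sym \<Rightarrow> sym) set" where
  "Wmaps = {f. Vector_Spaces.linear scale scale f \<and> (\<forall>x. f x \<in> Spow 1)}"

lemma cochains_iff_Wmaps:
  "f \<in> cochains n \<longleftrightarrow> f \<in> Wmaps \<and> (\<forall>k x. k \<noteq> n \<longrightarrow> x \<in> Spow k \<longrightarrow> f x = 0)"
  by (auto simp: cochains_def Wmaps_def)

definition coord :: "(sym \<Rightarrow> sym) \<Rightarrow> nat \<times> nat \<times> nat \<Rightarrow> nat \<Rightarrow> complex" where
  "coord f J j = coeff_at (f (mon J)) (gen_index j)"

lemma coord_add: "coord (f + g) J j = coord f J j + coord g J j"
  and coord_cscale: "coord (cscale c f) J j = c * coord f J j"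
  and coord_zero: "coord 0 J j = 0"
  by (simp_all add: coord_def cscale_def coeff_at_linear)

lemma coord_sum: "coord (\<Sum>a\<in>A. f a) J j = (\<Sum>a\<in>A. coord (f a) J j)"
  by (induction A rule: infinite_finite_induct) (simp_all add: coord_def coeff_at_zero coeff_at_add)

lemma Wmaps_eqI:
  assumes f: "f \<in> Wmaps" and g: "g \<in> Wmaps"
    and coord: "\<And>J j. valid_index J \<Longrightarrow> j \<in> {1, 2, 3} \<Longrightarrow> coord f J j = coord g J j"
  shows "f = g"
proof (rule linear_eq_on_mon)
  fix K assume K: "valid_index K"
  show "f (mon K) = g (mon K)"
  proof (rule sym_eqI)
    fix I
    show "coeff_at (f (mon K)) I = coeff_at (g (mon K)) I"
    proof (cases "msize I = 1")
      case True
      then obtain j where "j \<in> {1, 2, 3}" "I = gen_index j" by (rule msize_1_cases)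
      then show ?thesis using coord[OF K, of j] by (simp add: coord_def)
    next
      case False
      have "f (mon K) \<in> Spow 1" "g (mon K) \<in> Spow 1" using f g by (auto simp: Wmaps_def)
      then show ?thesis using False by (simp add: Spow_iff del: split_paired_All)
    qed
  qed
qed (use f g in \<open>simp_all add: Wmaps_def\<close>)

lemma Wmaps_zero: "0 \<in> Wmaps"
  and Wmaps_add: "f \<in> Wmaps \<Longrightarrow> g \<in> Wmaps \<Longrightarrow> f + g \<in> Wmaps"
  and Wmaps_cscale: "f \<in> Wmaps \<Longrightarrow> cscale c f \<in> Wmaps"
  by (auto simp: Wmaps_def linear_scale_iff Spow_iff cscale_def coeff_at_linear algebra_simps
      simp del: One_nat_def msize.simps intro!: sym_eqI)

lemma cochains_zero: "0 \<in> cochains n"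
  and cochains_add: "f \<in> cochains n \<Longrightarrow> g \<in> cochains n \<Longrightarrow> f + g \<in> cochains n"
  and cochains_cscale: "f \<in> cochains n \<Longrightarrow> cscale c f \<in> cochains n"
  using Wmaps_zero Wmaps_add[of f g] Wmaps_cscale[of f c]
  by (auto simp: cochains_iff_Wmaps cscale_def scale_zero_right)

lemma cochains_sum: "(\<And>a. a \<in> A \<Longrightarrow> f a \<in> cochains n) \<Longrightarrow> (\<Sum>a\<in>A. f a) \<in> cochains n"
  by (induction A rule: infinite_finite_induct) (auto simp: cochains_zero cochains_add)

lemma mon_in_Spow: "mon J \<in> Spow (msize J)"
  by (auto simp: Spow_iff coeff_at_mon)

lemma coord_cochain:
  assumes "f \<in> cochains n" "msize J \<noteq> n"
  shows "coord f J j = 0"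
proof -
  have "f (mon J) = 0" using assms mon_in_Spow[of J] by (auto simp: cochains_def)
  then show ?thesis by (simp add: coord_def coeff_at_zero)
qed

lemma coord_phi:
  assumes "j \<in> {1, 2, 3}" "i \<in> {1, 2, 3}" "valid_index I"
  shows "coord (phi I i) J j = of_nat (mfact I) * of_bool (J = I \<and> j = i)"
  using assms inj_gen_index valid_gen_index[of i]
  by (auto simp: coord_def phi_def coeff_at_scale coeff_at_mon inj_on_def)

lemma finite_valid_msize: "finite {J. valid_index J \<and> msize J = n}"
proof (rule finite_subset)
  show "{J. valid_index J \<and> msize J = n} \<subseteq> {..n} \<times> {..n} \<times> {..n}" by auto
qed auto

lemma mfact_nonzero: "mfact J \<noteq> 0"
  by (cases J rule: mfact.cases) auto

text \<open>This will produce primitives of cocycles from prescribed coordinates. There are finitely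
  many monomials of degree \<open>n\<close>, so the sum over the maps \<open>phi J j\<close> is
  finite, and dividing by \<open>mfact J\<close> cancels the factorial built into
  \<open>phi\<close>.\<close>

lemma ex_cochain_coord:
  obtains f where "f \<in> cochains n"
    "\<And>J j. valid_index J \<Longrightarrow> msize J = n \<Longrightarrow> j \<in> {1, 2, 3} \<Longrightarrow> coord f J j = a J j"
proof
  let ?S = "{J. valid_index J \<and> msize J = n}"
  let ?f = "\<Sum>J\<in>?S. \<Sum>j\<in>{1, 2, 3}. cscale (a J j / of_nat (mfact J)) (phi J j)"
  show "?f \<in> cochains n"
    by (intro cochains_sum cochains_cscale) (use phi_in_cochains in auto)
  fix J j assume J: "valid_index J" "msize J = n" and j: "j \<in> {1, 2, 3::nat}"
  have "coord ?f J j = (\<Sum>I\<in>?S. \<Sum>i\<in>{1, 2, 3}. a I i / of_nat (mfact I) * coord (phi I i) J j)"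
    by (simp only: coord_sum coord_cscale)
  also have "\<dots> = (\<Sum>I\<in>?S. if I = J then \<Sum>i\<in>{1, 2, 3}. if i = j then a J j else 0 else 0)"
    using j by (intro sum.cong refl) (auto simp: coord_phi mfact_nonzero simp del: sum.insert intro!: sum.neutral)
  also have "\<dots> = a J j"
    using J j finite_valid_msize[of n] by (simp add: sum.delta del: sum.insert)
  finally show "coord ?f J j = a J j" .
qed


subsection \<open>The coboundary operator in coordinates\<close>

text \<open>The summation range in \<open>coext\<close> depends on the argument. A common finite
  range for \<open>x\<close>, \<open>y\<close>, \<open>x + y\<close> and a multiple of
  \<open>x\<close> is what makes linearity a termwise computation.\<close>

lemma coext_superset:
  assumes "finite S" "Poly_Mapping.keys x \<subseteq> S"
  shows "coext f x = (\<Sum>K\<in>S. \<Sum>J\<in>mbelow (Rep_mindex K). \<Sum>j\<in>{1, 2, 3}.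
     (Poly_Mapping.lookup x K * of_nat (mbinom (Rep_mindex K) J) * coeff_at (f (mon J)) (gen_index j))
       \<bullet>s mon (gen_index j + (Rep_mindex K - J)))"
  unfolding coext_def using assms
  by (intro sum.mono_neutral_left) (auto simp: in_keys_iff scale_zero_left)

lemma linear_coext: "Vector_Spaces.linear scale scale (coext f)"
  unfolding linear_scale_iff
proof (intro conjI allI)
  fix x y :: sym and c :: complex
  let ?S = "Poly_Mapping.keys x \<union> Poly_Mapping.keys y \<union> Poly_Mapping.keys (x + y) \<union> Poly_Mapping.keys (c \<bullet>s x)"
  have S: "finite ?S" by simp
  note e = coext_superset[OF S, of _ f]
  have "coext f x + coext f y = coext f (x + y)"
    by (subst (1 2 3) e) (auto simp: lookup_add coeff_at_linear algebra_simps sum.distrib simp del: sum.insert intro!: sym_eqI)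
  then show "coext f (x + y) = coext f x + coext f y" ..
  show "coext f (c \<bullet>s x) = c \<bullet>s coext f x"
    by (subst (1 2) e) (auto simp: lookup_scale coeff_at_linear sum_distrib_left algebra_simps simp del: sum.insert intro!: sym_eqI)
qed

lemma coext_mon:
  assumes "valid_index K"
  shows "coext f (mon K) = (\<Sum>J\<in>mbelow K. \<Sum>j\<in>{1, 2, 3}.
    (of_nat (mbinom K J) * coord f J j) \<bullet>s mon (gen_index j + (K - J)))"
  using assms by (simp add: coext_def coord_def mon_def Abs_mindex_inverse)

section \<open>Parity components of linear maps\<close>

lemma linear_parity_proj: "Vector_Spaces.linear scale scale (parity_proj p)"
  by (auto simp: linear_scale_iff parity_proj_def coeff_at_restr coeff_at_linear intro!: sym_eqI)

lemma parity_proj_sum: "valid_index I \<Longrightarrow> coeff_at (parity_proj 0 x) I + coeff_at (parity_proj 1 x) I = coeff_at x I"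
  by (cases I) (auto simp: parity_proj_def coeff_at_restr valid_index_def)

lemma parity_decomposition: "parity_proj 0 x + parity_proj (Suc 0) x = x"
  using parity_proj_sum by (auto simp: coeff_at_linear intro!: sym_eqI)

lemma parity_proj_add2: "parity_proj (Suc (Suc 0)) = parity_proj 0"
  by (simp add: parity_proj_def)

lemma hpart_sum:
  assumes "Vector_Spaces.linear scale scale f"
  shows "hpart 0 f x + hpart (Suc 0) f x = f x"
proof -
  interpret f: Vector_Spaces.linear scale scale f by (rule assms)
  have "hpart 0 f x + hpart (Suc 0) f x =
      (parity_proj 0 (f (parity_proj 0 x)) + parity_proj (Suc 0) (f (parity_proj 0 x))) +
      (parity_proj 0 (f (parity_proj (Suc 0) x)) + parity_proj (Suc 0) (f (parity_proj (Suc 0) x)))"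
    by (simp add: hpart_def parity_proj_add2 algebra_simps)
  also have "\<dots> = f (parity_proj 0 x + parity_proj (Suc 0) x)"
    by (subst f.add) (simp only: parity_decomposition)
  finally show ?thesis by (simp only: parity_decomposition)
qed

lemma linear_hpart:
  assumes "Vector_Spaces.linear scale scale f"
  shows "Vector_Spaces.linear scale scale (hpart p f)"
  using assms linear_parity_proj
  by (auto simp: linear_scale_iff hpart_def coeff_at_linear algebra_simps intro!: sym_eqI)

text \<open>A monomial is homogeneous of parity \<open>fst K\<close>, so only one of the two
  summands of \<open>hpart\<close> survives.\<close>

lemma hpart_mon: "valid_index K \<Longrightarrow> f 0 = 0 \<Longrightarrow> hpart p f (mon K) = parity_proj (p + fst K) (f (mon K))"
proof -
  assume K: "valid_index K" and 0: "f 0 = 0"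
  have z: "parity_proj q 0 = 0" for q by (simp add: parity_proj_def restr_def)
  have "parity_proj q (mon K) = (if fst K mod 2 = q mod 2 then mon K else 0)" for q
    by (auto simp: parity_proj_def coeff_at_restr coeff_at_mon coeff_at_zero intro!: sym_eqI)
  moreover have "fst K = 0 \<or> fst K = 1" using K by (auto simp: valid_index_def)
  ultimately show ?thesis by (auto simp: hpart_def 0 z)
qed

section \<open>Corestriction and the bracket with \<open>d_star\<close>\<close>

lemma linear_corestr: "Vector_Spaces.linear scale scale corestr"
  by (auto simp: linear_scale_iff corestr_def coeff_at_restr coeff_at_linear intro!: sym_eqI)

text \<open>\<open>mon J\<close> is 0 for an invalid index. This default matters at
  \<open>(0, 0, 0)\<close>, which the coordinate formulas reach when an exponent is lowered.\<close>

lemma coord_outside: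
  assumes "f \<in> Wmaps" "\<not> valid_index J"
  shows "coord f J j = 0"
proof -
  interpret f: Vector_Spaces.linear scale scale f using assms by (simp add: Wmaps_def)
  show ?thesis using assms by (simp add: coord_def mon_def coeff_at_zero)
qed

lemma finite_mbelow: "finite (mbelow K)"
  by (cases K) auto

text \<open>A term \<open>gen_index j + (K - J)\<close> has degree 1 only if \<open>J = K\<close>.
  So corestriction keeps just the unshuffle in which \<open>f\<close> takes the whole monomial, and
  that one has binomial factor 1.\<close>

lemma corestr_coext:
  assumes f: "f \<in> Wmaps"
  shows "corestr (coext f x) = f x"
proof -
  have "(corestr \<circ> coext f) = f"
  proof (rule linear_eq_on_mon)
    show "Vector_Spaces.linear scale scale (corestr \<circ> coext f)"
      using linear_corestr linear_coext by (auto simp: linear_scale_iff)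
    show "Vector_Spaces.linear scale scale f" using f by (simp add: Wmaps_def)
    fix K assume K: "valid_index K"
    show "(corestr \<circ> coext f) (mon K) = f (mon K)"
    proof (rule sym_eqI)
      fix I :: "nat \<times> nat \<times> nat" assume I: "valid_index I"
      show "coeff_at ((corestr \<circ> coext f) (mon K)) I = coeff_at (f (mon K)) I"
      proof (cases "msize I = 1")
        case True
        then obtain i where i: "i \<in> {1, 2, 3}" "I = gen_index i" by (rule msize_1_cases)
        have eq: "gen_index j + (K - J) = gen_index i \<longleftrightarrow> j = i \<and> J = K"
          if "j \<in> {1, 2, 3}" "J \<in> mbelow K" for j J
          using that i(1) by (cases K; cases J) (auto simp: gen_index_def split: if_splits)
        have bin: "mbinom K K = 1" by (cases K) auto
        have KK: "K \<in> mbelow K" by (cases K) auto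
        have "coeff_at (coext f (mon K)) I =
            (\<Sum>J\<in>mbelow K. \<Sum>j\<in>{1, 2, 3}. of_nat (mbinom K J) * coord f J j * of_bool (j = i \<and> J = K))"
          unfolding coext_mon[OF K] coeff_at_sum coeff_at_scale i(2)
          by (intro sum.cong refl) (use valid_gen_index[OF i(1)] eq in \<open>auto simp: coeff_at_mon\<close>)
        also have "\<dots> = (\<Sum>J\<in>mbelow K. if J = K then coord f K i else 0)"
          using i(1) by (intro sum.cong refl) (auto simp: bin)
        also have "\<dots> = coord f K i"
          using KK by (simp add: finite_mbelow)
        finally show ?thesis using True by (simp add: corestr_def coeff_at_restr coord_def i(2))
      next
        case False
        then show ?thesis using f
          by (simp add: Wmaps_def Spow_iff corestr_def coeff_at_restr del: split_paired_All)
      qed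
    qed
  qed
  then show ?thesis by (simp add: fun_eq_iff)
qed

lemma d_star_in_Wmaps: "d_star \<in> Wmaps"
  using codifferential_d_star by (simp add: codifferential_def cochains_iff_Wmaps)

lemma coext_d_star_parity1: "coext d_star (parity_proj (Suc 0) x) = coext d_star x"
proof -
  interpret d: Vector_Spaces.linear scale scale "coext d_star" by (rule linear_coext)
  have "coext d_star x = coext d_star (parity_proj 0 x + parity_proj (Suc 0) x)"
    by (simp add: parity_decomposition)
  then show ?thesis by (simp add: d.add coext_d_star_parity0)
qed

lemma hpart_coext_zero: "hpart p (coext f) 0 = 0"
  by (simp add: hpart_def parity_proj_def restr_def coext_zero)

text \<open>The coderivation of \<open>d_star\<close> is purely odd, so the sign in the graded
  commutator is -1 to the parity of the part of \<open>coext f\<close>. In the first product the two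
  parts add up to \<open>coext f\<close>; in the second they enter with opposite signs.
  Corestriction then turns the outer coderivation of each product back into \<open>f\<close> or
  \<open>d_star\<close>.\<close>

lemma bracket_d_star:
  assumes f: "f \<in> Wmaps"
  shows "bracket f d_star x = f (coext d_star x) - d_star (hpart 0 (coext f) x - hpart 1 (coext f) x)"
proof -
  interpret c: Vector_Spaces.linear scale scale corestr by (rule linear_corestr)
  interpret d: Vector_Spaces.linear scale scale "coext d_star" by (rule linear_coext)
  have m1: "(-1) \<bullet>s y = - y" "1 \<bullet>s y = y" for y by (auto simp: coeff_at_linear intro!: sym_eqI poly_mapping_eqI simp: lookup_scale)
  have "gcomm (coext f) (coext d_star) x =
      (hpart 0 (coext f) (coext d_star x) + hpart (Suc 0) (coext f) (coext d_star x))
      - (coext d_star (hpart 0 (coext f) x) - coext d_star (hpart (Suc 0) (coext f) x))"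
    by (simp add: gcomm_def hpart_coext_d_star[unfolded One_nat_def] coext_d_star_parity1 hpart_coext_zero m1
        scale_zero_right)
  also have "\<dots> = coext f (coext d_star x) - coext d_star (hpart 0 (coext f) x - hpart 1 (coext f) x)"
    by (simp add: hpart_sum linear_coext d.diff)
  finally show ?thesis
    by (simp add: bracket_def c.diff corestr_coext f d_star_in_Wmaps)
qed

lemma bracket_d_star_in_Wmaps:
  assumes f: "f \<in> Wmaps"
  shows "bracket f d_star \<in> Wmaps"
proof -
  interpret f: Vector_Spaces.linear scale scale f using f by (simp add: Wmaps_def)
  interpret d: Vector_Spaces.linear scale scale d_star using d_star_in_Wmaps by (simp add: Wmaps_def)
  interpret c: Vector_Spaces.linear scale scale "coext d_star" by (rule linear_coext)
  interpret h: Vector_Spaces.linear scale scale "hpart p (coext f)" for p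
    by (rule linear_hpart[OF linear_coext])
  have scale_diff: "c \<bullet>s (x - y) = c \<bullet>s x - c \<bullet>s y" for c x y
    by (rule sym_eqI) (simp add: coeff_at_linear right_diff_distrib)
  have "Vector_Spaces.linear scale scale (bracket f d_star)"
    unfolding linear_scale_iff bracket_d_star[OF f]
    by (simp add: f.add f.scale d.add d.diff d.scale c.add c.scale h.add h.scale
        scale_diff algebra_simps)
  then show ?thesis
    by (simp add: Wmaps_def bracket_def corestr_def Spow_iff coeff_at_restr)
qed

lemma coord_d_star: "j \<in> {1, 2, 3} \<Longrightarrow> coord d_star J j = of_bool (J = (1, 1, 0) \<and> j = 3)"
  by (simp add: d_star_def coord_phi valid_index_def)

text \<open>The only contributing unshuffles feed one \<open>w1\<close> and one \<open>w2\<close> to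
  \<open>d_star\<close> and put \<open>w3\<close> in their place; there are \<open>a * b\<close> of
  them. The truncated \<open>b - 1\<close> is harmless, since the factor is 0 when
  \<open>b = 0\<close>.\<close>

lemma coext_d_star_mon:
  assumes "valid_index K"
  shows "coext d_star (mon K) = (case K of (a, b, c) \<Rightarrow> of_nat (a * b) \<bullet>s mon (0, b - 1, c + 1))"
proof (rule sym_eqI)
  fix I :: "nat \<times> nat \<times> nat" assume I: "valid_index I"
  obtain a b c where K: "K = (a, b, c)" by (metis prod_cases3)
  have a: "a \<le> 1" using assms by (simp add: K valid_index_def)
  have "coeff_at (coext d_star (mon K)) I =
    (\<Sum>J\<in>mbelow K. if J = (1, 1, 0) then of_nat (a * b) * coeff_at (mon (gen_index 3 + (K - J))) I else 0)"
    unfolding coext_mon[OF assms] coeff_at_sum coeff_at_scale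
    by (intro sum.cong refl) (use a in \<open>auto simp: coord_d_star K\<close>)
  also have "\<dots> = (if (1, 1, 0) \<in> mbelow K then of_nat (a * b) * coeff_at (mon (gen_index 3 + (K - (1, 1, 0)))) I else 0)"
    by (simp only: sum.delta finite_mbelow if_True)
  also have "\<dots> = of_nat (a * b) * coeff_at (mon (0, b - 1, c + 1)) I"
    using a by (auto simp: K gen_index_def)
  finally show "coeff_at (coext d_star (mon K)) I =
      coeff_at (case K of (a, b, c) \<Rightarrow> of_nat (a * b) \<bullet>s mon (0, b - 1, c + 1)) I"
    by (simp add: K coeff_at_scale)
qed


text \<open>The coefficient of \<open>w1 w2\<close> is the only one that \<open>d_star\<close> sees.
  It arises in two ways: \<open>f\<close> takes all but one \<open>w2\<close> and returns
  \<open>w1\<close>, with \<open>b\<close> choices, or \<open>f\<close> takes all but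
  \<open>w1\<close> and returns \<open>w2\<close>, possible only for \<open>a = 1\<close>.\<close>

lemma coeff_coext_mon:
  assumes "valid_index (a, b, c)"
  shows "coeff_at (coext f (mon (a, b, c))) (1, 1, 0) =
    of_nat b * coord f (a, b - 1, c) 1 + of_nat a * coord f (0, b, c) 2"
proof -
  have v: "valid_index (1, 1, 0)" by (simp add: valid_index_def)
  have a: "a = 0 \<or> a = 1" using assms by (auto simp: valid_index_def)
  have summand: "(\<Sum>j\<in>{1, 2, 3}. of_nat (mbinom (a, b, c) J) * coord f J j * of_bool (gen_index j + ((a, b, c) - J) = (1, 1, 0))) =
      (if J = (a, b - 1, c) then of_nat b * coord f (a, b - 1, c) 1 else 0) +
      (if J = (0, b, c) then of_nat a * coord f (0, b, c) 2 else 0)"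
    if J: "J \<in> mbelow (a, b, c)" for J
  proof -
    obtain x y z where J': "J = (x, y, z)" by (metis prod_cases3)
    have le: "x \<le> a" "y \<le> b" "z \<le> c" using J by (auto simp: J')
    have 1: "gen_index 1 + ((a, b, c) - J) = (1, 1, 0) \<longleftrightarrow> 0 < b \<and> J = (a, b - 1, c)"
      using le by (auto simp: gen_index_def J')
    have 2: "gen_index 2 + ((a, b, c) - J) = (1, 1, 0) \<longleftrightarrow> a = 1 \<and> J = (0, b, c)"
      using le a by (auto simp: gen_index_def J')
    have 3: "gen_index 3 + ((a, b, c) - J) \<noteq> (1, 1, 0)"
      by (auto simp: gen_index_def J')
    have sum: "(\<Sum>j\<in>{1, 2, 3}. h j) = h 1 + (h 2 + h 3)" for h :: "nat \<Rightarrow> complex" by simp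
    have bin: "0 < b \<Longrightarrow> mbinom (a, b, c) (a, b - 1, c) = b" "a = 1 \<Longrightarrow> mbinom (a, b, c) (0, b, c) = 1"
      by (cases b; simp)+
    show ?thesis
      unfolding sum 1 2 using 3 bin a by auto
  qed
  have "coeff_at (coext f (mon (a, b, c))) (1, 1, 0) =
    (\<Sum>J\<in>mbelow (a, b, c). \<Sum>j\<in>{1, 2, 3}.
       of_nat (mbinom (a, b, c) J) * coord f J j * of_bool (gen_index j + ((a, b, c) - J) = (1, 1, 0)))"
    unfolding coext_mon[OF assms] coeff_at_sum coeff_at_scale coeff_at_mon using v
    by (intro sum.cong refl) auto
  also have "\<dots> = (\<Sum>J\<in>mbelow (a, b, c).
      (if J = (a, b - 1, c) then of_nat b * coord f (a, b - 1, c) 1 else 0) +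
      (if J = (0, b, c) then of_nat a * coord f (0, b, c) 2 else 0))"
    by (rule sum.cong[OF refl summand])
  also have "\<dots> = of_nat b * coord f (a, b - 1, c) 1 + of_nat a * coord f (0, b, c) 2"
    unfolding sum.distrib by (subst (1 2) sum.delta) (auto simp: finite_mbelow)
  finally show ?thesis .
qed

text \<open>The monomial \<open>w1 w2\<close> is odd and the argument has parity \<open>a\<close>,
  so the coefficient seen by \<open>d_star\<close> lies in the part of \<open>coext f\<close> of
  parity \<open>a + 1\<close>. This gives the sign. The second term is confined to
  \<open>j = 3\<close> because \<open>d_star\<close> takes values in the span of
  \<open>w3\<close>.\<close>

lemma coord_bracket_d_star:
  assumes f: "f \<in> Wmaps" and K: "valid_index (a, b, c)" and j: "j \<in> {1, 2, 3}"
  shows "coord (bracket f d_star) (a, b, c) j =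
    of_nat (a * b) * coord f (0, b - 1, c + 1) j -
    (-1) ^ (a + 1) * of_bool (j = 3) * (of_nat b * coord f (a, b - 1, c) 1 + of_nat a * coord f (0, b, c) 2)"
proof -
  interpret f: Vector_Spaces.linear scale scale f using f by (simp add: Wmaps_def)
  have a: "a = 0 \<or> a = 1" using K by (auto simp: valid_index_def)
  have v: "valid_index (1, 1, 0)" by (simp add: valid_index_def)
  have d: "coeff_at (d_star y) (gen_index j) = of_bool (j = 3) * coeff_at y (1, 1, 0)" for y
    using j inj_gen_index valid_gen_index[of 3]
    by (auto simp: d_star_def phi_def coeff_at_scale coeff_at_mon inj_on_def)
  show ?thesis
    using a unfolding coord_def bracket_d_star[OF f] coeff_at_diff d
      hpart_mon[OF K, of "coext f", OF coext_zero] coext_d_star_mon[OF K]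
    using coeff_coext_mon[OF K, of f]
    by (auto simp: f.scale coeff_at_scale parity_proj_def coeff_at_restr coord_def)
qed

subsection \<open>Cocycles and coboundaries\<close>

lemma coord_coboundary_even:
  assumes f: "f \<in> Wmaps" and j: "j \<in> {1, 2, 3}"
  shows "coord (coboundary d_star f) (0, b, c) j = of_bool (j = 3) * of_nat b * coord f (0, b - 1, c) 1"
proof (cases "valid_index (0, b, c)")
  case True
  then show ?thesis
    using coord_bracket_d_star[OF f True j] by (simp add: coboundary_def)
next
  \<comment> \<open>The only invalid index of this shape is \<open>(0, 0, 0)\<close>, where the
    factor \<open>b\<close> makes the right-hand side 0 as well.\<close>
  case False
  then show ?thesis
    using coord_outside[OF bracket_d_star_in_Wmaps[OF f] False]
    by (simp add: coboundary_def valid_index_def)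
qed

lemma coord_coboundary_odd:
  assumes f: "f \<in> Wmaps" and j: "j \<in> {1, 2, 3}"
  shows "coord (coboundary d_star f) (1, b, c) j =
    of_nat b * coord f (0, b - 1, Suc c) j -
    of_bool (j = 3) * (of_nat b * coord f (1, b - 1, c) 1 + coord f (0, b, c) 2)"
  using coord_bracket_d_star[OF f _ j, of 1 b c] by (simp add: coboundary_def valid_index_def)

lemma coboundary_in_Wmaps: "f \<in> Wmaps \<Longrightarrow> coboundary d_star f \<in> Wmaps"
  by (simp add: coboundary_def bracket_d_star_in_Wmaps)

lemma valid_index_cases:
  assumes "valid_index J"
  obtains b c where "J = (0, b, c)" | b c where "J = (1, b, c)"
  using assms by (cases J) (auto simp: valid_index_def le_Suc_eq)

lemma coord_eqI:
  assumes "f \<in> Wmaps" "g \<in> Wmaps"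
    and "\<And>b c j. j \<in> {1, 2, 3} \<Longrightarrow> coord f (0, b, c) j = coord g (0, b, c) j"
    and "\<And>b c j. j \<in> {1, 2, 3} \<Longrightarrow> coord f (1, b, c) j = coord g (1, b, c) j"
  shows "f = g"
proof (rule Wmaps_eqI[OF assms(1,2)])
  fix J :: "nat \<times> nat \<times> nat" and j :: nat
  assume "valid_index J" and j: "j \<in> {1, 2, 3}"
  then show "coord f J j = coord g J j"
    by (elim valid_index_cases) (use assms(3,4)[OF j] in auto)
qed

text \<open>Linearity in the cochain is visible in the coordinate formulas, where the parity
  projections of the bracket have already been resolved.\<close>

lemma coboundary_add:
  assumes "f \<in> Wmaps" "g \<in> Wmaps"
  shows "coboundary d_star (f + g) = coboundary d_star f + coboundary d_star g"
  using assms
  by (intro coord_eqI)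
    (simp_all add: coord_coboundary_even coord_coboundary_odd coboundary_in_Wmaps Wmaps_add coord_add
      algebra_simps del: plus_fun_apply One_nat_def)

lemma coboundary_cscale:
  assumes "f \<in> Wmaps"
  shows "coboundary d_star (cscale c f) = cscale c (coboundary d_star f)"
  using assms
  by (intro coord_eqI)
    (simp_all add: coord_coboundary_even coord_coboundary_odd coboundary_in_Wmaps Wmaps_cscale coord_cscale
      algebra_simps del: One_nat_def)

lemma coboundary_zero: "coboundary d_star 0 = 0"
proof -
  have "cscale 0 f = 0" for f by (simp add: cscale_def scale_zero_left fun_eq_iff)
  then show ?thesis using coboundary_cscale[OF Wmaps_zero, of 0] by simp
qed

lemma cochainsD: "f \<in> cochains n \<Longrightarrow> f \<in> Wmaps"
  by (simp add: cochains_iff_Wmaps)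

interpretation coboundary_subspace d_star n for n
proof
  show "0 \<in> coboundaries d_star n"
    using cochains_zero coboundary_zero by (auto simp: coboundaries_def image_iff intro!: bexI[of _ 0])
  show "f + g \<in> coboundaries d_star n" if "f \<in> coboundaries d_star n" "g \<in> coboundaries d_star n" for f g
    using that cochains_add[of _ "n - 1"] coboundary_add cochainsD unfolding coboundaries_def image_iff by metis
  show "cscale c f \<in> coboundaries d_star n" if "f \<in> coboundaries d_star n" for c f
    using that cochains_cscale[of _ "n - 1"] coboundary_cscale cochainsD unfolding coboundaries_def image_iff by metis
qed

text \<open>No monomial has degree 0, so the only cochain of degree 0 is 0.\<close>

lemma coboundaries_1: "coboundaries d_star 1 = {0}"
proof -
  have "f = 0" if f: "f \<in> cochains 0" for f
  proof (rule Wmaps_eqI[OF cochainsD[OF f] Wmaps_zero])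
    fix J j assume "valid_index J"
    then show "coord f J j = coord 0 J j"
      by (subst coord_cochain[OF f]) (auto simp only: coord_zero valid_index_def)
  qed
  then show ?thesis
    using cochains_zero coboundary_zero by (auto simp: coboundaries_def)
qed

lemma cocycles_zero: "0 \<in> cocycles d_star n"
  and cocycles_add: "f \<in> cocycles d_star n \<Longrightarrow> g \<in> cocycles d_star n \<Longrightarrow> f + g \<in> cocycles d_star n"
  and cocycles_cscale: "f \<in> cocycles d_star n \<Longrightarrow> cscale c f \<in> cocycles d_star n"
  by (auto simp: cocycles_def cochains_zero cochains_add cochains_cscale coboundary_zero coboundary_add
      coboundary_cscale cochainsD simp del: plus_fun_apply)
    (simp add: cscale_def scale_zero_right fun_eq_iff)

section \<open>Parity in coordinates, and explicit cocycles and coboundaries\<close>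

lemma coord_hpart:
  assumes f: "f \<in> Wmaps" and J: "valid_index J" and j: "j \<in> {1, 2, 3}"
  shows "coord (hpart p f) J j = of_bool (even (p + fst J + of_bool (j = 1))) * coord f J j"
proof -
  interpret f: Vector_Spaces.linear scale scale f using f by (simp add: Wmaps_def)
  show ?thesis using j
    by (auto simp: coord_def hpart_mon[OF J] parity_proj_def coeff_at_restr gen_index_def mod_2_eq_odd)
qed

lemma hpart_in_Wmaps:
  assumes f: "f \<in> Wmaps"
  shows "hpart p f \<in> Wmaps"
  using assms linear_hpart[of f p]
  by (auto simp: Wmaps_def hpart_def parity_proj_def Spow_iff coeff_at_linear coeff_at_restr
      simp del: split_paired_All)

lemma hpart_eq_iff:
  assumes f: "f \<in> Wmaps"
  shows "hpart p f = f \<longleftrightarrow> (\<forall>J j. valid_index J \<longrightarrow> j \<in> {1, 2, 3} \<longrightarrow>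
    odd (p + fst J + of_bool (j = 1)) \<longrightarrow> coord f J j = 0)" (is "_ \<longleftrightarrow> ?R")
proof
  assume hp: "hpart p f = f"
  show ?R
  proof (intro allI impI)
    fix J j assume "valid_index J" "j \<in> {1, 2, 3::nat}" "odd (p + fst J + of_bool (j = 1))"
    then show "coord f J j = 0"
      using coord_hpart[OF f, of J j p, unfolded hp] by (cases "j = 1") auto
  qed
next
  assume R: ?R
  show "hpart p f = f"
  proof (rule Wmaps_eqI[OF hpart_in_Wmaps[OF f] f])
    fix J j assume "valid_index J" "j \<in> {1, 2, 3::nat}"
    then show "coord (hpart p f) J j = coord f J j"
      using R[rule_format, of J j] coord_hpart[OF f, of J j p]
      by (cases "odd (p + fst J + of_bool (j = 1))") simp_all
  qed
qed

text \<open>These are the equations \<open>p\<^sub>3' = 0\<close>, \<open>q\<^sub>2' = 0\<close> and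
  \<open>q\<^sub>3' = 0\<close> at \<open>Suc b\<close>, with the nonzero factor
  \<open>Suc b\<close> cancelled in the first two. The equation \<open>q\<^sub>1' = 0\<close>
  follows from the first condition.\<close>

lemma cocycles_iff:
  "f \<in> cocycles d_star n \<longleftrightarrow> f \<in> cochains n \<and>
    (\<forall>b c. coord f (0, b, c) 1 = 0) \<and>
    (\<forall>b c. coord f (0, b, Suc c) 2 = 0) \<and>
    (\<forall>b c. of_nat (Suc b) * (coord f (0, b, Suc c) 3 - coord f (1, b, c) 1) = coord f (0, Suc b, c) 2)"
  (is "_ \<longleftrightarrow> _ \<and> ?P1 \<and> ?P2 \<and> ?P3")
proof (intro iffI conjI allI; (elim conjE)?)
  fix b c
  assume f: "f \<in> cocycles d_star n"
  then show "f \<in> cochains n" by (simp add: cocycles_def)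
  then have W: "f \<in> Wmaps" by (rule cochainsD)
  have D: "coord (coboundary d_star f) J j = 0" for J j
    using f by (simp only: cocycles_def mem_Collect_eq coord_zero)
  show "coord f (0, b, c) 1 = 0"
    using D[of "(0, Suc b, c)" 3] coord_coboundary_even[OF W, of 3 "Suc b" c]
    by (simp del: of_nat_Suc)
  show "coord f (0, b, Suc c) 2 = 0"
    using D[of "(1, Suc b, c)" 2] coord_coboundary_odd[OF W, of 2 "Suc b" c]
    by (simp del: of_nat_Suc)
  show "of_nat (Suc b) * (coord f (0, b, Suc c) 3 - coord f (1, b, c) 1) = coord f (0, Suc b, c) 2"
    using D[of "(1, Suc b, c)" 3] coord_coboundary_odd[OF W, of 3 "Suc b" c]
    by (simp add: algebra_simps)
next
  assume f: "f \<in> cochains n" and P: ?P1 ?P2 ?P3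
  have W: "f \<in> Wmaps" using f by (rule cochainsD)
  \<comment> \<open>At \<open>b = 0\<close> the equation \<open>q\<^sub>3' = 0\<close> demands
    \<open>p\<^sub>2(0,c) = 0\<close>. The second condition covers \<open>c > 0\<close>; for
    \<open>c = 0\<close> the index is not that of a monomial.\<close>
  have "coord f (0, 0, 0) 2 = 0" using W by (rule coord_outside) (simp add: valid_index_def)
  with P(2) have P2: "coord f (0, 0, c) 2 = 0" for c by (cases c) auto
  have "coboundary d_star f = 0"
  proof (rule coord_eqI[OF coboundary_in_Wmaps[OF W] Wmaps_zero])
    fix b c :: nat and j :: nat assume j: "j \<in> {1, 2, 3}"
    show "coord (coboundary d_star f) (0, b, c) j = coord 0 (0, b, c) j"
      unfolding coord_coboundary_even[OF W j] coord_zero using P by simp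
    show "coord (coboundary d_star f) (1, b, c) j = coord 0 (1, b, c) j"
      unfolding coord_coboundary_odd[OF W j] coord_zero
    proof (cases b)
      case 0
      then show "of_nat b * coord f (0, b - 1, Suc c) j -
          of_bool (j = 3) * (of_nat b * coord f (1, b - 1, c) 1 + coord f (0, b, c) 2) = 0"
        using P2 by simp
    next
      case (Suc b')
      then show "of_nat b * coord f (0, b - 1, Suc c) j -
          of_bool (j = 3) * (of_nat b * coord f (1, b - 1, c) 1 + coord f (0, b, c) 2) = 0"
        using P(1,2) P(3)[rule_format, of b' c, symmetric] j by (auto simp: right_diff_distrib)
    qed
  qed
  with f show "f \<in> cocycles d_star n" by (simp add: cocycles_def)
qed

lemma coboundaryI:
  assumes n: "1 < n" and f: "f \<in> cocycles d_star n"
    and q2: "coord f (1, 0, n - 1) 2 = 0"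
    and q23: "coord f (1, 0, n - 1) 3 + coord f (1, 1, n - 2) 2 = 0"
    and p2: "coord f (0, n, 0) 2 = 0"
    and p3: "coord f (0, 0, n) 3 = 0"
  shows "f \<in> coboundaries d_star n"
proof -
  \<comment> \<open>The primitive is sought with zero coordinates on monomials containing
    \<open>w1\<close>. Then \<open>P1\<close>, \<open>P2\<close> and \<open>P3\<close> solve the
    equations for \<open>p\<^sub>3'\<close>, \<open>q\<^sub>2'\<close> and \<open>q\<^sub>3'\<close>
    in this order. The value of \<open>P2\<close> at \<open>c = 0\<close> is a free choice, which
    \<open>P3\<close> absorbs.\<close>
  define P1 where "P1 b c = coord f (0, Suc b, c) 3 / of_nat (Suc b)" for b c
  define P2 where "P2 b c = (case c of 0 \<Rightarrow> 0 | Suc c \<Rightarrow> coord f (1, Suc b, c) 2 / of_nat (Suc b))" for b c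
  define P3 where "P3 b c = (case c of 0 \<Rightarrow> 0
    | Suc c \<Rightarrow> (coord f (1, Suc b, c) 3 + P2 (Suc b) c) / of_nat (Suc b))" for b c
  have fc: "f \<in> cochains n" and p1_0: "\<And>b c. coord f (0, b, c) 1 = 0"
    and p2_0: "\<And>b c. coord f (0, b, Suc c) 2 = 0"
    and p2_eq: "\<And>b c. of_nat (Suc b) * (coord f (0, b, Suc c) 3 - coord f (1, b, c) 1) = coord f (0, Suc b, c) 2"
    using f by (auto simp only: cocycles_iff)
  have size: "coord f (a, b, c) j = 0" if "a + b + c \<noteq> n" for a b c j
    using coord_cochain[OF fc] that by simp
  \<comment> \<open>For \<open>c > 0\<close> this is a cocycle condition; for \<open>c = 0\<close>
    the degree leaves only \<open>b = n\<close>, which is the hypothesis \<open>p2\<close>.\<close>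
  have p2_0': "coord f (0, b, c) 2 = 0" for b c
    using p2_0 p2 size[of 0 b c] by (cases c; cases "b = n") auto
  \<comment> \<open>With \<open>p\<^sub>2 = 0\<close> the last cocycle condition links
    \<open>p\<^sub>3\<close> and \<open>q\<^sub>1\<close>, so the \<open>P1\<close> fitted to
    \<open>p\<^sub>3\<close> also yields the right \<open>q\<^sub>1\<close>.\<close>
  have p3_q1: "coord f (0, b, Suc c) 3 = coord f (1, b, c) 1" for b c
    using p2_eq[of b c] p2_0' by (simp del: of_nat_Suc)
  obtain g where g: "g \<in> cochains (n - 1)" and
    g_coord: "\<And>J j. valid_index J \<Longrightarrow> msize J = n - 1 \<Longrightarrow> j \<in> {1, 2, 3} \<Longrightarrow> coord g J j =
      (case J of (a, b, c) \<Rightarrow> if a = 1 then 0 else if j = 1 then P1 b c else if j = 2 then P2 b c else P3 b c)"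
    using ex_cochain_coord[where n = "n - 1" and
      a = "\<lambda>J j. case J of (a, b, c) \<Rightarrow> if a = 1 then 0 else if j = 1 then P1 b c else if j = 2 then P2 b c else P3 b c"]
    by blast
  have gsize: "coord g (a, b, c) j = 0" if "a + b + c \<noteq> n - 1" for a b c j
    using coord_cochain[OF g] that by simp
  \<comment> \<open>The formulas vanish by themselves outside degree \<open>n - 1\<close>, so they
    describe \<open>g\<close> for all exponents.\<close>
  have Psize: "P1 b c = 0 \<and> P2 b c = 0 \<and> P3 b c = 0" if "b + c \<noteq> n - 1" for b c
    using that n by (auto simp: P1_def P2_def P3_def size split: nat.splits)
  have g0: "coord g (0, b, c) 1 = P1 b c" "coord g (0, b, c) 2 = P2 b c" "coord g (0, b, c) 3 = P3 b c" for b c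
    using g_coord[of "(0, b, c)"] gsize[of 0 b c] Psize[of b c] n
    by (cases "b + c = n - 1"; simp add: valid_index_def)+
  have g1: "coord g (1, b, c) 1 = 0" for b c
    using g_coord[of "(1, b, c)" 1] gsize[of 1 b c] by (cases "1 + b + c = n - 1") (simp_all add: valid_index_def)
  have W: "g \<in> Wmaps" "f \<in> Wmaps" using g fc by (auto intro: cochainsD)
  have "coboundary d_star g = f"
  proof (rule coord_eqI[OF coboundary_in_Wmaps[OF W(1)] W(2)])
    fix b c :: nat and j :: nat assume j: "j \<in> {1, 2, 3}"
    have p3': "coord f (0, 0, c) 3 = 0" using p3 size[of 0 0 c] by (cases "c = n") auto
    have "of_nat b * P1 (b - 1) c = coord f (0, b, c) 3"
      by (cases b) (simp_all add: P1_def p3' del: of_nat_Suc)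
    then show "coord (coboundary d_star g) (0, b, c) j = coord f (0, b, c) j"
      using j by (auto simp: coord_coboundary_even[OF W(1) j] g0[unfolded One_nat_def] p1_0[unfolded One_nat_def] p2_0')
    show "coord (coboundary d_star g) (1, b, c) j = coord f (1, b, c) j"
    proof (cases b)
      case 0
      have 1: "coord f (1, 0, c) 1 = 0"
        using p3_q1[of 0 c] p3 size[of 0 0 "Suc c"] by (cases "Suc c = n") auto
      have 2: "coord f (1, 0, c) 2 = 0"
        using q2 size[of 1 0 c] by (cases "Suc c = n") auto
      \<comment> \<open>At \<open>b = 0\<close> nothing can be solved for: the coboundary of
        \<open>g\<close> has \<open>- P2 0 c\<close> here, and \<open>q23\<close> says that
        \<open>f\<close> agrees. As \<open>n > 1\<close>, the relevant \<open>c\<close> is a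
        successor, so the nontrivial case of \<open>P2\<close> applies.\<close>
      have "coord f (1, 0, c) 3 = - P2 0 c"
      proof (cases "Suc c = n")
        case True
        with n obtain c' where "c = Suc c'" by (cases c) auto
        then show ?thesis using True q23 by (auto simp: P2_def eq_neg_iff_add_eq_0)
      next
        case False
        then show ?thesis using Psize[of 0 c] size[of 1 0 c] n by auto
      qed
      with 0 1 2 j show ?thesis
        by (auto simp: coord_coboundary_odd[OF W(1) j, unfolded One_nat_def] g0 p2_0')
    next
      case (Suc b')
      then show ?thesis
        using j p3_q1[of b c]
        by (auto simp: coord_coboundary_odd[OF W(1) j, unfolded One_nat_def] g0[unfolded One_nat_def]
            g1[unfolded One_nat_def] P1_def P2_def P3_def simp del: of_nat_Suc)
    qed
  qed
  with g show ?thesis by (auto simp: coboundaries_def)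
qed

text \<open>At \<open>b = 0\<close> the factor \<open>b\<close> leaves only the term
  \<open>- p\<^sub>2(0,c)\<close> of the primitive in \<open>q\<^sub>3'(0,c)\<close>. In the second
  equation this cancels against \<open>q\<^sub>2'(1,c-1)\<close>, which is why those two coordinates
  must be combined into one functional.\<close>

lemma coord_of_coboundary:
  assumes "f \<in> coboundaries d_star n"
  shows "coord f (1, 0, c) 2 = 0" "coord f (1, 0, Suc c) 3 + coord f (1, 1, c) 2 = 0"
    "coord f (0, b, c) 2 = 0" "coord f (0, 0, c) 3 = 0"
proof -
  obtain g where f: "f = coboundary d_star g" and g: "g \<in> Wmaps"
    using assms cochainsD by (auto simp: coboundaries_def)
  show "coord f (1, 0, c) 2 = 0" "coord f (1, 0, Suc c) 3 + coord f (1, 1, c) 2 = 0"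
    "coord f (0, b, c) 2 = 0" "coord f (0, 0, c) 3 = 0"
    using coord_coboundary_odd[OF g] coord_coboundary_even[OF g] by (simp_all add: f)
qed

text \<open>Of the nine coordinates in degree 1 the cocycle conditions kill three and express
  \<open>p\<^sub>3(0,1)\<close> as \<open>q\<^sub>1(0,0) + p\<^sub>2(1,0)\<close>. The five assumed
  to vanish are the remaining ones.\<close>

lemma cocycle_1_eq_zeroI:
  assumes f: "f \<in> cocycles d_star 1"
    and coords: "coord f (1, 0, 0) 2 = 0" "coord f (1, 0, 0) 3 = 0" "coord f (0, 1, 0) 3 = 0"
      "coord f (1, 0, 0) 1 = 0" "coord f (0, 1, 0) 2 = 0"
  shows "f = 0"
proof -
  have fc: "f \<in> cochains 1" and 1: "\<And>b c. coord f (0, b, c) 1 = 0"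
    and 2: "\<And>b c. coord f (0, b, Suc c) 2 = 0"
    and 3: "\<And>b c. of_nat (Suc b) * (coord f (0, b, Suc c) 3 - coord f (1, b, c) 1) = coord f (0, Suc b, c) 2"
    using f by (auto simp only: cocycles_iff)
  have 4: "coord f (0, 0, 1) 3 = 0" using 3[of 0 0] coords by simp
  show ?thesis
  proof (rule Wmaps_eqI[OF cochainsD[OF fc] Wmaps_zero])
    fix J j assume j: "j \<in> {1, 2, 3::nat}"
    show "coord f J j = coord 0 J j"
    proof (cases "msize J = 1")
      case True
      then obtain i where "i \<in> {1, 2, 3}" "J = gen_index i" by (rule msize_1_cases)
      then show ?thesis
        unfolding coord_zero using j 1[unfolded One_nat_def] 2[of 0 0] 4 coords by (auto simp: gen_index_def)
    next
      case False
      then show ?thesis unfolding coord_zero by (rule coord_cochain[OF fc])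
    qed
  qed
qed

section \<open>Homogeneous cocycles and the representatives\<close>

definition parity_cocycles :: "nat \<Rightarrow> nat \<Rightarrow> (sym \<Rightarrow> sym) set" where
  "parity_cocycles n p = {f \<in> cocycles d_star n. hpart p f = f}"

lemma parity_cocycles_iff:
  "f \<in> parity_cocycles n p \<longleftrightarrow> f \<in> cocycles d_star n \<and> (\<forall>J j. valid_index J \<longrightarrow> j \<in> {1, 2, 3} \<longrightarrow>
    odd (p + fst J + of_bool (j = 1)) \<longrightarrow> coord f J j = 0)"
  using hpart_eq_iff[of f p] cochainsD by (auto simp only: parity_cocycles_def cocycles_iff mem_Collect_eq)

lemma parity_cocycles_zero: "0 \<in> parity_cocycles n p"
  and parity_cocycles_add: "f \<in> parity_cocycles n p \<Longrightarrow> g \<in> parity_cocycles n p \<Longrightarrow> f + g \<in> parity_cocycles n p"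
  and parity_cocycles_cscale: "f \<in> parity_cocycles n p \<Longrightarrow> cscale c f \<in> parity_cocycles n p"
  unfolding parity_cocycles_iff coord_add coord_cscale coord_zero
  by (simp_all add: cocycles_zero cocycles_add cocycles_cscale del: split_paired_All plus_fun_apply)

lemma phi_cochain: "valid_index I \<Longrightarrow> j \<in> {1, 2, 3} \<Longrightarrow> msize I = n \<Longrightarrow> phi I j \<in> cochains n"
  using phi_in_cochains by blast

text \<open>The third cocycle condition couples \<open>p\<^sub>3(b,c+1)\<close>,
  \<open>q\<^sub>1(b,c)\<close> and \<open>p\<^sub>2(b+1,c)\<close>; each of the two sums balances
  two of these. With the factorials in \<open>phi\<close> this amounts to
  \<open>(m+1) m! = (m+1)!\<close>, which explains the coefficient \<open>Suc m\<close> in one sum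
  and its absence in the other. The single maps have none of these coordinates.\<close>

lemma
  shows psi_2_cocycle: "psi (1, 0, m) 2 \<in> parity_cocycles (Suc m) 1"
    and psi_3_cocycle: "psi (1, 0, m) 3 \<in> parity_cocycles (Suc m) 1"
    and phi_23_cocycle: "phi (0, Suc m, 0) 2 + phi (0, m, 1) 3 \<in> parity_cocycles (Suc m) 0"
    and phi_31_cocycle: "phi (0, 0, Suc m) 3 + cscale (of_nat (Suc m)) (phi (1, 0, m) 1) \<in> parity_cocycles (Suc m) 0"
    and phi_3_cocycle: "phi (0, Suc m, 0) 3 \<in> parity_cocycles (Suc m) 0"
  unfolding parity_cocycles_iff cocycles_iff
  by (auto simp: coord_add coord_cscale coord_phi valid_index_def algebra_simps
      simp del: plus_fun_apply intro!: cochains_add cochains_cscale phi_cochain)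


lemma parity_cocycle_is_cocycle: "f \<in> parity_cocycles n p \<Longrightarrow> f \<in> cocycles d_star n"
  by (simp add: parity_cocycles_def)

lemmas cocycles_subspace = cocycles_zero cocycles_add cocycles_cscale
lemmas parity_cocycles_subspace = parity_cocycles_zero parity_cocycles_add parity_cocycles_cscale

lemma classes_form_basis_iff:
  "classes_form_basis d_star n fs \<longleftrightarrow> set fs \<subseteq> cocycles d_star n \<and> distinct (map (cohom_class d_star n) fs) \<and>
    vectorspace.basis class_ring ((cohomology d_star n)\<lparr>carrier := cohom_class d_star n ` cocycles d_star n\<rparr>)
      (cohom_class d_star n ` set fs)"
  unfolding classes_form_basis_def cohomology_eq_cohomology_of[symmetric] ..

lemma cohomology_part_eq:
  "cohomology_part d_star n p = (cohomology d_star n)\<lparr>carrier := cohom_class d_star n ` parity_cocycles n p\<rparr>"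
  by (simp add: cohomology_part_def parity_cocycles_def)

section \<open>Bases and superdimensions\<close>

lemma
  assumes m: "0 < m"
  shows cohomology_higher_basis: "classes_form_basis d_star (Suc m)
      [psi (1, 0, m) 2, psi (1, 0, m) 3, phi (0, Suc m, 0) 2 + phi (0, m, 1) 3,
       phi (0, 0, Suc m) 3 + cscale (of_nat (Suc m)) (phi (1, 0, m) 1)]"
    and cohomology_higher_sdim: "cohomology_sdim d_star (Suc m) = (2, 2)"
proof -
  let ?n = "Suc m"
  \<comment> \<open>These are the four obstructions to being a coboundary, divided by the factorials
    in \<open>phi\<close> so as to be dual to the representatives. Here \<open>m - 1\<close> is the
    exponent \<open>n - 2\<close> for \<open>n = Suc m\<close>.\<close>
  define l1 where "l1 f = coord f (1, 0, m) 2 / fact m" for f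
  define l2 where "l2 f = (coord f (1, 0, m) 3 + coord f (1, 1, m - 1) 2) / fact m" for f
  define l3 where "l3 f = coord f (0, ?n, 0) 2 / fact ?n" for f
  define l4 where "l4 f = coord f (0, 0, ?n) 3 / fact ?n" for f
  note l_defs = l1_def l2_def l3_def l4_def
  have add: "l (f + g) = l f + l g" and scale: "l (cscale c f) = c * l f"
    if "l \<in> {l1, l2, l3, l4}" for l f g c
    using that by (auto simp: l_defs coord_add coord_cscale add_divide_distrib distrib_left
        simp del: plus_fun_apply fact_Suc)
  have vanish: "l f = 0" if "l \<in> {l1, l2, l3, l4}" "f \<in> coboundaries d_star ?n" for l f
    using that coord_of_coboundary[of f ?n] coord_of_coboundary(2)[of f ?n "m - 1"] m
    by (auto simp: l_defs simp del: fact_Suc)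
  have separate: "f \<in> coboundaries d_star ?n"
    if "f \<in> cocycles d_star ?n" "l1 f = 0" "l2 f = 0" "l3 f = 0" "l4 f = 0" for f
    using that m by (intro coboundaryI) (auto simp: l_defs simp del: fact_Suc)
  \<comment> \<open>\<open>l1\<close> and \<open>l2\<close> read only odd coordinates,
    \<open>l3\<close> and \<open>l4\<close> only even ones. On cocycles of one parity two
    functionals vanish, so the other two already detect coboundaries, which gives the dimension of
    each part.\<close>
  have even: "f \<in> cocycles d_star ?n" "l1 f = 0" "l2 f = 0" if "f \<in> parity_cocycles ?n 0" for f
    using that by (auto simp: parity_cocycles_iff l_defs valid_index_def)
  have odd: "f \<in> cocycles d_star ?n" "l3 f = 0" "l4 f = 0" if "f \<in> parity_cocycles ?n 1" for f
    using that by (auto simp: parity_cocycles_iff l_defs valid_index_def simp del: fact_Suc)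
  let ?o1 = "psi (1, 0, m) 2" and ?o2 = "psi (1, 0, m) 3"
  let ?e1 = "phi (0, Suc m, 0) 2 + phi (0, m, 1) 3"
  let ?e2 = "phi (0, 0, Suc m) 3 + cscale (of_nat (Suc m)) (phi (1, 0, m) 1)"
  have dual:
    "l1 ?o1 = 1" "l1 ?o2 = 0" "l1 ?e1 = 0" "l1 ?e2 = 0"
    "l2 ?o1 = 0" "l2 ?o2 = 1" "l2 ?e1 = 0" "l2 ?e2 = 0"
    "l3 ?o1 = 0" "l3 ?o2 = 0" "l3 ?e1 = 1" "l3 ?e2 = 0"
    "l4 ?o1 = 0" "l4 ?o2 = 0" "l4 ?e1 = 0" "l4 ?e2 = 1"
    using m by (auto simp: l_defs coord_add coord_cscale coord_phi valid_index_def
        simp del: plus_fun_apply of_nat_Suc mult_Suc)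
  have even_cocycles: "?e1 \<in> parity_cocycles ?n 0" "?e2 \<in> parity_cocycles ?n 0"
    by (fact phi_23_cocycle phi_31_cocycle)+
  have odd_cocycles: "?o1 \<in> parity_cocycles ?n 1" "?o2 \<in> parity_cocycles ?n 1"
    by (fact psi_2_cocycle psi_3_cocycle)+
  have cocycles: "set [?o1, ?o2, ?e1, ?e2] \<subseteq> cocycles d_star ?n"
    using even_cocycles[THEN parity_cocycle_is_cocycle] odd_cocycles[THEN parity_cocycle_is_cocycle]
    by (simp only: list.set insert_subset empty_subsetI simp_thms)
  have "distinct (map (cohom_class d_star ?n) [?o1, ?o2, ?e1, ?e2]) \<and>
    vectorspace.basis class_ring ((cohomology d_star ?n)\<lparr>carrier := cohom_class d_star ?n ` cocycles d_star ?n\<rparr>)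
      (cohom_class d_star ?n ` set [?o1, ?o2, ?e1, ?e2]) \<and>
    vectorspace.dim class_ring ((cohomology d_star ?n)\<lparr>carrier := cohom_class d_star ?n ` cocycles d_star ?n\<rparr>) =
      length [?o1, ?o2, ?e1, ?e2]"
    by (rule cohomology_of_dual_functionals[where ls = "[l1, l2, l3, l4]", OF cocycles_subspace cocycles])
      (use add scale vanish separate in \<open>simp_all add: All_less_Suc dual[unfolded One_nat_def] del: of_nat_Suc plus_fun_apply\<close>)
  with cocycles show "classes_form_basis d_star ?n [?o1, ?o2, ?e1, ?e2]"
    by (simp only: classes_form_basis_iff simp_thms)
  have "vectorspace.dim class_ring (cohomology_part d_star ?n 0) = length [?e1, ?e2]"
    unfolding cohomology_part_eq
    by (rule cohomology_of_dual_functionals[where ls = "[l3, l4]", OF parity_cocycles_subspace,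
          THEN conjunct2, THEN conjunct2])
      (use add scale vanish separate even even_cocycles in
        \<open>simp_all add: All_less_Suc dual[unfolded One_nat_def] del: of_nat_Suc plus_fun_apply\<close>)
  moreover have "vectorspace.dim class_ring (cohomology_part d_star ?n 1) = length [?o1, ?o2]"
    unfolding cohomology_part_eq
    by (rule cohomology_of_dual_functionals[where ls = "[l1, l2]", OF parity_cocycles_subspace,
          THEN conjunct2, THEN conjunct2])
      (use add scale vanish separate odd odd_cocycles in
        \<open>simp_all add: All_less_Suc dual[unfolded One_nat_def] del: of_nat_Suc plus_fun_apply\<close>)
  ultimately show "cohomology_sdim d_star ?n = (2, 2)"
    by (simp add: cohomology_sdim_def)
qed

lemma
  shows cohomology_1_basis: "classes_form_basis d_star 1
      [psi (1, 0, 0) 2, psi (1, 0, 0) 3, phi (0, 1, 0) 3, phi (0, 0, 1) 3 + phi (1, 0, 0) 1,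
       phi (0, 1, 0) 2 + phi (0, 0, 1) 3]"
    and cohomology_1_sdim: "cohomology_sdim d_star 1 = (3, 2)"
proof -
  define l1 where "l1 f = coord f (1, 0, 0) 2" for f
  define l2 where "l2 f = coord f (1, 0, 0) 3" for f
  define l3 where "l3 f = coord f (0, 1, 0) 3" for f
  \<comment> \<open>Both \<open>?e2\<close> and \<open>?e3\<close> have a nonzero
    \<open>p\<^sub>3(0,1)\<close>. Reading \<open>q\<^sub>1(0,0)\<close> and
    \<open>p\<^sub>2(1,0)\<close> instead tells them apart and makes the functionals dual; every
    factorial involved is 1.\<close>
  define l4 where "l4 f = coord f (1, 0, 0) 1" for f
  define l5 where "l5 f = coord f (0, 1, 0) 2" for f
  note l_defs = l1_def l2_def l3_def l4_def l5_def
  have add: "l (f + g) = l f + l g" and scale: "l (cscale c f) = c * l f"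
    if "l \<in> {l1, l2, l3, l4, l5}" for l f g c
    using that by (auto simp: l_defs coord_add coord_cscale simp del: plus_fun_apply)
  have vanish: "l f = 0" if "l \<in> {l1, l2, l3, l4, l5}" "f \<in> coboundaries d_star 1" for l f
    using that unfolding coboundaries_1 by (auto simp only: l_defs coord_zero singleton_iff insert_iff empty_iff)
  have separate: "f \<in> coboundaries d_star 1"
    if "f \<in> cocycles d_star 1" "l1 f = 0" "l2 f = 0" "l3 f = 0" "l4 f = 0" "l5 f = 0" for f
    unfolding coboundaries_1 using cocycle_1_eq_zeroI[of f] that by (simp add: l_defs)
  have even: "f \<in> cocycles d_star 1" "l1 f = 0" "l2 f = 0" if "f \<in> parity_cocycles 1 0" for f
    using that by (auto simp: parity_cocycles_iff l_defs valid_index_def)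
  have odd: "f \<in> cocycles d_star 1" "l3 f = 0" "l4 f = 0" "l5 f = 0" if "f \<in> parity_cocycles 1 1" for f
    using that by (auto simp: parity_cocycles_iff l_defs valid_index_def)
  let ?o1 = "psi (1, 0, 0) 2" and ?o2 = "psi (1, 0, 0) 3"
  let ?e1 = "phi (0, 1, 0) 3"
  let ?e2 = "phi (0, 0, 1) 3 + phi (1, 0, 0) 1"
  let ?e3 = "phi (0, 1, 0) 2 + phi (0, 0, 1) 3"
  have dual:
    "l1 ?o1 = 1" "l1 ?o2 = 0" "l1 ?e1 = 0" "l1 ?e2 = 0" "l1 ?e3 = 0"
    "l2 ?o1 = 0" "l2 ?o2 = 1" "l2 ?e1 = 0" "l2 ?e2 = 0" "l2 ?e3 = 0"
    "l3 ?o1 = 0" "l3 ?o2 = 0" "l3 ?e1 = 1" "l3 ?e2 = 0" "l3 ?e3 = 0"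
    "l4 ?o1 = 0" "l4 ?o2 = 0" "l4 ?e1 = 0" "l4 ?e2 = 1" "l4 ?e3 = 0"
    "l5 ?o1 = 0" "l5 ?o2 = 0" "l5 ?e1 = 0" "l5 ?e2 = 0" "l5 ?e3 = 1"
    by (simp_all add: l_defs coord_add coord_phi valid_index_def del: plus_fun_apply)
  have cscale_1: "cscale 1 f = f" for f
    by (auto simp: cscale_def fun_eq_iff lookup_scale intro!: poly_mapping_eqI)
  have even_cocycles: "?e1 \<in> parity_cocycles 1 0" "?e2 \<in> parity_cocycles 1 0" "?e3 \<in> parity_cocycles 1 0"
    using phi_3_cocycle[of 0] phi_31_cocycle[of 0] phi_23_cocycle[of 0] by (simp_all add: cscale_1 del: plus_fun_apply)
  have odd_cocycles: "?o1 \<in> parity_cocycles 1 1" "?o2 \<in> parity_cocycles 1 1"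
    using psi_2_cocycle[of 0] psi_3_cocycle[of 0] by simp_all
  have cocycles: "set [?o1, ?o2, ?e1, ?e2, ?e3] \<subseteq> cocycles d_star 1"
    using even_cocycles[THEN parity_cocycle_is_cocycle] odd_cocycles[THEN parity_cocycle_is_cocycle]
    by (simp only: list.set insert_subset empty_subsetI simp_thms)
  have "distinct (map (cohom_class d_star 1) [?o1, ?o2, ?e1, ?e2, ?e3]) \<and>
    vectorspace.basis class_ring ((cohomology d_star 1)\<lparr>carrier := cohom_class d_star 1 ` cocycles d_star 1\<rparr>)
      (cohom_class d_star 1 ` set [?o1, ?o2, ?e1, ?e2, ?e3]) \<and>
    vectorspace.dim class_ring ((cohomology d_star 1)\<lparr>carrier := cohom_class d_star 1 ` cocycles d_star 1\<rparr>) =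
      length [?o1, ?o2, ?e1, ?e2, ?e3]"
    by (rule cohomology_of_dual_functionals[where ls = "[l1, l2, l3, l4, l5]", OF cocycles_subspace cocycles])
      (use add scale vanish separate in \<open>simp_all add: All_less_Suc dual[unfolded One_nat_def] del: plus_fun_apply\<close>)
  with cocycles show "classes_form_basis d_star 1 [?o1, ?o2, ?e1, ?e2, ?e3]"
    by (simp only: classes_form_basis_iff simp_thms)
  have "vectorspace.dim class_ring (cohomology_part d_star 1 0) = length [?e1, ?e2, ?e3]"
    unfolding cohomology_part_eq
    by (rule cohomology_of_dual_functionals[where ls = "[l3, l4, l5]", OF parity_cocycles_subspace,
          THEN conjunct2, THEN conjunct2])
      (use add scale vanish separate even even_cocycles in
        \<open>simp_all add: All_less_Suc dual[unfolded One_nat_def] del: of_nat_Suc plus_fun_apply\<close>)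
  moreover have "vectorspace.dim class_ring (cohomology_part d_star 1 1) = length [?o1, ?o2]"
    unfolding cohomology_part_eq
    by (rule cohomology_of_dual_functionals[where ls = "[l1, l2]", OF parity_cocycles_subspace,
          THEN conjunct2, THEN conjunct2])
      (use add scale vanish separate odd odd_cocycles in
        \<open>simp_all add: All_less_Suc dual[unfolded One_nat_def] del: of_nat_Suc plus_fun_apply\<close>)
  ultimately show "cohomology_sdim d_star 1 = (3, 2)"
    by (simp add: cohomology_sdim_def)
qed

theorem mainTheorem4:
  shows
    "classes_form_basis d_star 1
       [psi (1, 0, 0) 2,
        psi (1, 0, 0) 3,
        phi (0, 1, 0) 3,
        phi (0, 0, 1) 3 + phi (1, 0, 0) 1,
        phi (0, 1, 0) 2 + phi (0, 0, 1) 3] \<and>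
     (\<forall>n>1. classes_form_basis d_star n
       [psi (1, 0, n - 1) 2,
        psi (1, 0, n - 1) 3,
        phi (0, n, 0) 2 + phi (0, n - 1, 1) 3,
        phi (0, 0, n) 3 + cscale (of_nat n) (phi (1, 0, n - 1) 1)]) \<and>
     cohomology_sdim d_star 1 = (3, 2) \<and>
     (\<forall>n>1. cohomology_sdim d_star n = (2, 2))"
proof (intro conjI allI impI)
  fix n :: nat
  assume "1 < n"
  then have m: "0 < n - 1" and n: "Suc (n - 1) = n" by simp_all
  show "classes_form_basis d_star n
       [psi (1, 0, n - 1) 2,
        psi (1, 0, n - 1) 3,
        phi (0, n, 0) 2 + phi (0, n - 1, 1) 3,
        phi (0, 0, n) 3 + cscale (of_nat n) (phi (1, 0, n - 1) 1)]"
    using cohomology_higher_basis[OF m] unfolding n .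
  show "cohomology_sdim d_star n = (2, 2)"
    using cohomology_higher_sdim[OF m] unfolding n .
qed (fact cohomology_1_basis cohomology_1_sdim)+

end
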